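(* Let $n\ge 2$, let $k\ge 2$ be an integer, let $l\in k\mathbb{N}^{\ast}$, and let $\mathcal{A}$ be a set of curves of $\mathbb{R}^n$ which satisfies (H) for $(k,l)$. Let $R$ be a pairing relation on $E=\{e_1,-e_1,\ldots,e_n,-e_n\}$. If the covering $\widehat{\mathcal{A}}_R$ satisfies (C), then $\widehat{\mathcal{A}}_R$ satisfies the local isomorphism property.
   Context: Curves. Let $(e_1,\ldots,e_n)$ be the canonical basis of $\mathbb{R}^n$. A segment is a non-oriented interval $[x,x+e_i]$ with $x\in\mathbb{Z}^n$, $1\le i\le n$. A curve is a nonoriented sequence of segments (a sequence and its reversal are the same curve), finite or indexed by $\mathbb{N}$ or by $\mathbb{Z}$, such that (i) two consecutive segments have one and only one common endpoint, and (ii) the common endpoints of a segment with the preceding one and with the following one, when these exist, are different. Two consecutive segments of a curve are said to be connected at their common endpoint (this is called a connexion). A curve is self-avoiding if each of its segments appears only once; two curves are disjoint if they have no common segment. A set of self-avoiding curves covers $X\subset\mathbb{R}^n$ if each segment containing a point of $X$ appears in one and only one of the curves; it is a covering of $\mathbb{R}^n$ if it covers $\mathbb{R}^n$. For sets of curves, $\mathcal{E}\prec\mathcal{F}$ means that each segment of a curve of $\mathcal{E}$ is a segment of a curve of $\mathcal{F}$ and each connexion between two segments of a curve of $\mathcal{E}$ also exists in $\mathcal{F}$. (H) and convolution. For $k\in\mathbb{N}^{\ast}$ and $l\in k\mathbb{N}^{\ast}$, $\mathcal{A}$ satisfies (H) for $(k,l)$ if $\mathcal{A}$ is a covering of $\mathbb{R}^n$,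 each curve of $\mathcal{A}$ has endpoints $x,x+ke_i$ with $x\in k\mathbb{Z}^n$ and $1\le i\le n$, any two such points $x,x+ke_i$ are joined by a unique curve of $\mathcal{A}$, and $\mathcal{A}$ is invariant under all translations by vectors of $l\mathbb{Z}^n$. For such $\mathcal{A}$ and any set $\mathcal{B}$ of disjoint self-avoiding curves, $\mathcal{A}\ast\mathcal{B}$ is obtained by applying to $\mathcal{B}$ the homothety of center $0$ and ratio $k$, then replacing each of the resulting intervals by the curve of $\mathcal{A}$ with the same endpoints. Let $\mathcal{A}^0$ be the set of all one-segment curves and $\mathcal{A}^{s+1}=\mathcal{A}\ast\mathcal{A}^s$. Then $\mathcal{A}^s\prec\mathcal{A}^{s+1}$ for all $s$. $\widehat{\mathcal{A}}$ denotes the inductive limit of the $\mathcal{A}^s$ for $\prec$ (two segments are connected in $\widehat{\mathcal{A}}$ iff they are connected in some $\mathcal{A}^s$); its connexions are defined at every point of $\mathbb{Z}^n$ except $0$. A pairing relation $R$ on $E$ partitions $E$ into pairs of distinct related elements. $\widehat{\mathcal{A}}_R$ is the covering by curves without endpoints obtained from $\widehat{\mathcal{A}}$ by connecting the segments with endpoint $0$ according to $R$ ($[0,u]$ and $[0,v]$ are connected iff $R(u,v)$). Restrictions, (C), local isomorphism property. For $x\in\mathbb{Z}^n$, $h\in\mathbb{N}^{\ast}$, let $\mathrm{P}_{x,h}=[x_1-h,x_1+h]\times\cdots\times[x_n-h,x_n+h]$. $\mathcal{E}\upharpoonright\mathrm{P}_{x,h}$ denotes the restriction of $\mathcal{E}$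 to $\mathrm{P}_{x,h}$ (the segments contained in it, with the connexions of $\mathcal{E}$ between them), and $\cong$ means equality up to translation. A covering $\mathcal{E}$ satisfies (C) if for each $x\in\mathbb{Z}^n$ and $h\in\mathbb{N}^{\ast}$ there exists $y\in\mathbb{Z}^n-\mathrm{P}_{x,h}$ such that $\mathcal{E}\upharpoonright\mathrm{P}_{y,h}\cong\mathcal{E}\upharpoonright\mathrm{P}_{x,h}$. $\mathcal{E}$ satisfies the local isomorphism property if for each $x\in\mathbb{Z}^n$ and $h\in\mathbb{N}^{\ast}$ there exists $t\in\mathbb{R}^{+}$ such that each Euclidean ball of radius $t$ in $\mathbb{R}^n$ contains some $z\in\mathbb{Z}^n$ with $\mathcal{E}\upharpoonright\mathrm{P}_{z,h}\cong\mathcal{E}\upharpoonright\mathrm{P}_{x,h}$. *)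

theory Defs
  imports "HOL-Analysis.Analysis"
begin

text \<open>
  The lattice of integer points is \<open>int ^ 'n\<close>. A segment \<open>[x, x + e\<^sub>i]\<close> is represented by the set
  of its two endpoints, so that a segment lies in a (convex) box with integral bounds iff this set
  is a subset of the integer points of the box.
\<close>

type_synonym 'n segment = "(int ^ 'n) set"

definition segments :: "'n::finite segment set" where
  "segments = {{x, x + axis i 1} | x i. True}"

definition multiples :: "nat \<Rightarrow> (int ^ 'n::finite) set" where
  "multiples k = range (\<lambda>y. int k *s y)"

text \<open>
  A sequence of segments is a pair of an index set and an indexing function, which is only relevant
  on the index set. The nonempty intervals of the integers are, up to shift and reversal, the
  finite ones, the natural numbers, and all the integers. A nonoriented sequence is an equivalence
  class under shift and reversal of the indices.
\<close>

type_synonym 'n segseq = "int set \<times> (int \<Rightarrow> 'n segment)"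
type_synonym 'n curve = "'n segseq set"

definition same_curve :: "('n::finite segseq \<times> 'n segseq) set" where
  "same_curve = {((I, f), (J, g)). \<exists>\<phi>. (\<exists>c. \<phi> = (\<lambda>i. c + i) \<or> \<phi> = (\<lambda>i. c - i)) \<and>
     J = \<phi> ` I \<and> (\<forall>i\<in>I. g (\<phi> i) = f i)}"

definition curve_of :: "'n::finite segseq \<Rightarrow> 'n curve" where
  "curve_of p = same_curve `` {p}"

definition curve_seq :: "'n::finite segseq \<Rightarrow> bool" where
  "curve_seq = (\<lambda>(I, f). I \<noteq> {} \<and> (\<forall>i\<in>I. \<forall>j\<in>I. {i..j} \<subseteq> I) \<and> (\<forall>i\<in>I. f i \<in> segments) \<and>
     (\<forall>i. i \<in> I \<and> i + 1 \<in> I \<longrightarrow> (\<exists>!p. p \<in> f i \<and> p \<in> f (i + 1))) \<and>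
     (\<forall>i. i \<in> I \<and> i + 1 \<in> I \<and> i + 2 \<in> I \<longrightarrow> f i \<inter> f (i + 1) \<noteq> f (i + 1) \<inter> f (i + 2)))"

definition curves :: "'n::finite curve set" where
  "curves = curve_of ` Collect curve_seq"

definition self_avoiding :: "'n::finite curve \<Rightarrow> bool" where
  "self_avoiding C \<longleftrightarrow> (\<forall>(I, f)\<in>C. inj_on f I)"

definition segments_of :: "'n::finite curve \<Rightarrow> 'n segment set" where
  "segments_of C = (\<Union>(I, f)\<in>C. f ` I)"

definition connected_in :: "'n::finite curve set \<Rightarrow> 'n segment \<Rightarrow> 'n segment \<Rightarrow> bool" where
  "connected_in \<E> s t \<longleftrightarrow>
     (\<exists>C\<in>\<E>. \<exists>(I, f)\<in>C. \<exists>i. i \<in> I \<and> i + 1 \<in> I \<and> s = f i \<and> t = f (i + 1))"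

definition covering :: "'n::finite curve set \<Rightarrow> bool" where
  "covering \<E> \<longleftrightarrow> \<E> \<subseteq> curves \<and> (\<forall>C\<in>\<E>. self_avoiding C) \<and>
     (\<forall>s\<in>segments. \<exists>!C. C \<in> \<E> \<and> s \<in> segments_of C)"

text \<open>
  The part of the sequence \<open>f\<close> with indices \<open>a, \<dots>, b - 1\<close> is traversed from \<open>p\<close> to \<open>q\<close>; here
  \<open>v i\<close> and \<open>v (i + 1)\<close> are the initial and final points of the segment \<open>f i\<close>.
\<close>

definition leads :: "(int \<Rightarrow> 'n::finite segment) \<Rightarrow> int \<Rightarrow> int \<Rightarrow> int ^ 'n \<Rightarrow> int ^ 'n \<Rightarrow> bool" where
  "leads f a b p q \<longleftrightarrow> a < b \<and>
     (\<exists>v. v a = p \<and> v b = q \<and> (\<forall>i\<in>{a..<b}. f i = {v i, v (i + 1)}))"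

definition joins :: "'n::finite curve \<Rightarrow> int ^ 'n \<Rightarrow> int ^ 'n \<Rightarrow> bool" where
  "joins C p q \<longleftrightarrow> (\<exists>f a b. ({a..<b}, f) \<in> C \<and> leads f a b p q)"

definition translate_seg :: "int ^ 'n::finite \<Rightarrow> 'n segment \<Rightarrow> 'n segment" where
  "translate_seg w s = (\<lambda>p. w + p) ` s"

definition translate_curve :: "int ^ 'n::finite \<Rightarrow> 'n curve \<Rightarrow> 'n curve" where
  "translate_curve w C = (\<lambda>(I, f). (I, \<lambda>i. translate_seg w (f i))) ` C"

definition condition_H :: "nat \<Rightarrow> nat \<Rightarrow> 'n::finite curve set \<Rightarrow> bool" where
  "condition_H k l \<A> \<longleftrightarrow> covering \<A> \<and>
     (\<forall>C\<in>\<A>. \<exists>x\<in>multiples k. \<exists>i. joins C x (x + axis i (int k))) \<and>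
     (\<forall>x\<in>multiples k. \<forall>i. \<exists>!C. C \<in> \<A> \<and> joins C x (x + axis i (int k))) \<and>
     (\<forall>w\<in>multiples l. translate_curve w ` \<A> = \<A>)"

text \<open>
  The product \<open>\<A> * \<B>\<close>: the sequence \<open>(J, g)\<close> of a curve of \<open>\<B>\<close> runs through the points \<open>v j\<close>; the
  dilated interval from \<open>k v\<^sub>j\<close> to \<open>k v\<^sub>j\<^sub>+\<^sub>1\<close> is replaced by the part of \<open>(I, f)\<close> with indices from
  \<open>m j\<close> to \<open>m (j + 1) - 1\<close>, which is the curve of \<open>\<A>\<close> with the same endpoints.
\<close>

definition conv :: "nat \<Rightarrow> 'n::finite curve set \<Rightarrow> 'n curve set \<Rightarrow> 'n curve set" where
  "conv k \<A> \<B> = {curve_of (I, f) | I f. \<exists>D\<in>\<B>. \<exists>(J, g)\<in>D. \<exists>v m.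
     I = (\<Union>j\<in>J. {m j..<m (j + 1)}) \<and>
     (\<forall>j\<in>J. g j = {v j, v (j + 1)} \<and>
        curve_of ({m j..<m (j + 1)}, f) \<in> \<A> \<and>
        leads f (m j) (m (j + 1)) (int k *s v j) (int k *s v (j + 1)))}"

primrec conv_power :: "nat \<Rightarrow> 'n::finite curve set \<Rightarrow> nat \<Rightarrow> 'n curve set" where
  "conv_power k \<A> 0 = {curve_of ({0}, \<lambda>_. s) | s. s \<in> segments}"
| "conv_power k \<A> (Suc r) = conv k \<A> (conv_power k \<A> r)"

text \<open>The inductive limit of the powers of \<open>\<A>\<close> is given by its connexions.\<close>

definition limit_connected ::
    "nat \<Rightarrow> 'n::finite curve set \<Rightarrow> 'n segment \<Rightarrow> 'n segment \<Rightarrow> bool" where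
  "limit_connected k \<A> s t \<longleftrightarrow> (\<exists>r. connected_in (conv_power k \<A> r) s t)"

definition unit_vectors :: "(int ^ 'n::finite) set" where
  "unit_vectors = range (\<lambda>i. axis i 1) \<union> range (\<lambda>i. - axis i 1)"

definition pairing_on :: "'a set \<Rightarrow> ('a \<Rightarrow> 'a \<Rightarrow> bool) \<Rightarrow> bool" where
  "pairing_on X R \<longleftrightarrow> (\<forall>u v. R u v \<longrightarrow> u \<in> X \<and> v \<in> X \<and> u \<noteq> v \<and> R v u) \<and>
     (\<forall>u\<in>X. \<exists>!v. R u v)"

text \<open>
  A curve has no endpoints iff it is indexed by all the integers. The completed limit consists of
  all such curves whose consecutive segments are connected in the limit, or at \<open>0\<close> according
  to \<open>R\<close>. Under condition (H) and for a pairing \<open>R\<close>, each segment is so connected to exactly one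
  segment at each of its endpoints, and no finite cycle arises, so this set is a covering.
\<close>

definition completed_limit ::
    "nat \<Rightarrow> 'n::finite curve set \<Rightarrow> (int ^ 'n \<Rightarrow> int ^ 'n \<Rightarrow> bool) \<Rightarrow> 'n curve set" where
  "completed_limit k \<A> R = {curve_of (UNIV, f) | f. curve_seq (UNIV, f) \<and>
     (\<forall>i. limit_connected k \<A> (f i) (f (i + 1)) \<or>
        (\<exists>u v. f i = {0, u} \<and> f (i + 1) = {0, v} \<and> R u v))}"

definition cube :: "int ^ 'n::finite \<Rightarrow> nat \<Rightarrow> (int ^ 'n) set" where
  "cube x h = {y. \<forall>i. x $ i - int h \<le> y $ i \<and> y $ i \<le> x $ i + int h}"

type_synonym 'n pattern = "'n segment set \<times> ('n segment \<times> 'n segment) set"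

definition restriction :: "'n::finite curve set \<Rightarrow> (int ^ 'n) set \<Rightarrow> 'n pattern" where
  "restriction \<E> P =
     ({s. s \<subseteq> P \<and> (\<exists>C\<in>\<E>. s \<in> segments_of C)},
      {(s, t). s \<subseteq> P \<and> t \<subseteq> P \<and> connected_in \<E> s t})"

definition translation_equal :: "'n::finite pattern \<Rightarrow> 'n pattern \<Rightarrow> bool" where
  "translation_equal p q \<longleftrightarrow> (\<exists>w. fst q = translate_seg w ` fst p \<and>
     snd q = map_prod (translate_seg w) (translate_seg w) ` snd p)"

definition condition_C :: "'n::finite curve set \<Rightarrow> bool" where
  "condition_C \<E> \<longleftrightarrow> (\<forall>x. \<forall>h\<ge>1. \<exists>y. y \<notin> cube x h \<and>
     translation_equal (restriction \<E> (cube y h)) (restriction \<E> (cube x h)))"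

definition real_point :: "int ^ 'n::finite \<Rightarrow> real ^ 'n" where
  "real_point z = (\<chi> i. real_of_int (z $ i))"

definition local_isomorphism_property :: "'n::finite curve set \<Rightarrow> bool" where
  "local_isomorphism_property \<E> \<longleftrightarrow> (\<forall>x. \<forall>h\<ge>1. \<exists>t::real. t \<ge> 0 \<and>
     (\<forall>c. \<exists>z. real_point z \<in> cball c t \<and>
        translation_equal (restriction \<E> (cube z h)) (restriction \<E> (cube x h))))"

end

theory Submission
  imports Defs
begin

text \<open>
  By counting, each segment at a point \<open>k q\<close> is the end segment of exactly one of the curves of \<open>\<A>\<close>
  that replace the segments at \<open>q\<close>.
  Hence the connexions of \<open>\<A>\<^sup>r\<^sup>+\<^sup>1\<close> are those of \<open>\<A>\<close>, none of which is at a multiple of \<open>k\<close>, and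
  those induced at the points \<open>k q\<close> by the connexions of \<open>\<A>\<^sup>r\<close> at \<open>q\<close>. By induction, \<open>\<A>\<^sup>r\<close> connects
  every segment at each endpoint outside \<open>k\<^sup>r \<int>\<^sup>n\<close>, in a unique way, and its connexions are invariant
  under \<open>(l / k) k\<^sup>r \<int>\<^sup>n\<close>. A cube that avoids \<open>0\<close> also avoids \<open>k\<^sup>r \<int>\<^sup>n\<close> for large \<open>r\<close>, so that the
  pattern of the limit in it comes from \<open>\<A>\<^sup>r\<close> and recurs periodically. Condition (C), applied
  to a large cube around \<open>0\<close>, replaces any given cube by one that avoids \<open>0\<close>.
\<close>

section \<open>Segments and curves\<close>

text \<open>Restrictions record only segments and connexions, so curves are traded early for the
  relation \<open>connected_in\<close>; only \<open>linked_imp_connected\<close> has to build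
  infinite curves. The obstacle is that (H) does not openly forbid a curve of \<open>\<A>\<close> to
  run through a point k q in its interior, which would compete there with the connexions induced
  from q. The counting excludes this: the 2n directions at q give 2n end segments at k q, distinct
  because curves of a covering share no segment, and only 2n segments contain k q, so none is left
  for a passage. What happens in a power at k q can then be read off from the preceding power at q.
  Since 0 is fixed by the dilation, no power ever decides the connexions there; as \<open>R\<close>
  is an arbitrary pairing, a second copy of a pattern around 0 can only come from (C).\<close>

lemma segments_iff: "{x, y} \<in> segments \<longleftrightarrow> y - x \<in> unit_vectors"
proof
  assume "{x, y} \<in> segments"
  then obtain z i where "{x, y} = {z, z + axis i 1}" by (auto simp: segments_def)
  then show "y - x \<in> unit_vectors"
    by (auto simp: doubleton_eq_iff unit_vectors_def)
next
  assume "y - x \<in> unit_vectors"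
  then consider i where "y = x + axis i 1" | i where "x = y + axis i 1"
    by (auto simp: unit_vectors_def algebra_simps eq_diff_eq)
  then show "{x, y} \<in> segments"
    by cases (auto simp: segments_def insert_commute)
qed

lemma zero_notin_unit_vectors: "0 \<notin> unit_vectors"
  by (auto simp: unit_vectors_def axis_eq_0_iff)

lemma finite_unit_vectors: "finite (unit_vectors :: (int ^ 'n::finite) set)"
  by (simp add: unit_vectors_def)

lemma segment_neq: "{x, y} \<in> segments \<Longrightarrow> x \<noteq> y"
  using zero_notin_unit_vectors by (auto simp: segments_iff simp del: insert_absorb2)

lemma segment_cases:
  assumes "s \<in> segments" "p \<in> s"
  obtains y where "s = {p, y}" "y \<noteq> p"
proof -
  obtain x i where "s = {x, x + axis i 1}" using assms by (auto simp: segments_def)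
  moreover from this have "x \<noteq> x + axis i 1" by (simp add: axis_eq_0_iff)
  ultimately show thesis using assms that by (metis doubleton_eq_iff insertE singletonD)
qed

lemma multiples_iff: "x \<in> multiples m \<longleftrightarrow> (\<forall>i. int m dvd x $ i)"
proof
  assume "\<forall>i. int m dvd x $ i"
  then have "x = int m *s (\<chi> i. x $ i div int m)" by (simp add: vec_eq_iff)
  then show "x \<in> multiples m" unfolding multiples_def by blast
qed (auto simp: multiples_def)

lemma translate_seg_0: "translate_seg 0 s = s"
  by (simp add: translate_seg_def)

lemma translate_seg_add: "translate_seg w (translate_seg w' s) = translate_seg (w + w') s"
  by (simp add: translate_seg_def image_image add.assoc)

lemma translate_seg_insert:
  "translate_seg w {x, y} = {w + x, w + y}"
  by (simp add: translate_seg_def)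

lemma translate_seg_mem_segments: "translate_seg w s \<in> segments \<longleftrightarrow> s \<in> segments"
proof -
  have *: "translate_seg w s \<in> segments" if "s \<in> segments" for w and s :: "(int ^ 'n) set"
    using that by (auto simp: segments_def translate_seg_insert add.assoc[symmetric]) blast
  show ?thesis using *[of s w] *[of "translate_seg w s" "- w"]
    by (auto simp: translate_seg_add translate_seg_0)
qed

section \<open>Curves as classes of sequences under shift and reversal\<close>

lemma same_curve_iff:
  "((I, f), (J, g)) \<in> same_curve \<longleftrightarrow>
     (\<exists>c. J = (\<lambda>i. c + i) ` I \<and> (\<forall>i\<in>I. g (c + i) = f i)) \<or>
     (\<exists>c. J = (\<lambda>i. c - i) ` I \<and> (\<forall>i\<in>I. g (c - i) = f i))"
  unfolding same_curve_def by blast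

text \<open>The maps \<open>i \<mapsto> c + i\<close> and \<open>i \<mapsto> c - i\<close> form a
  group, the isometries of the integers. The four cases of transitivity are the compositions of a
  shift or reversal with another one.\<close>

lemma equiv_same_curve: "equiv UNIV (same_curve :: ('n::finite segseq \<times> 'n segseq) set)"
    (is "equiv UNIV ?S")
proof (rule equivI)
  show "?S \<subseteq> UNIV \<times> UNIV" by simp
  show "refl ?S"
  proof (rule refl_onI)
    fix p :: "'n segseq"
    show "(p, p) \<in> same_curve"
      by (cases p) (auto simp: same_curve_iff intro!: exI[of _ 0])
  qed
  show "sym ?S"
  proof (rule symI)
    fix p q :: "'n segseq"
    assume "(p, q) \<in> same_curve"
    then obtain I f J g c where pq: "p = (I, f)" "q = (J, g)" and
      "J = (\<lambda>i. c + i) ` I \<and> (\<forall>i\<in>I. g (c + i) = f i) \<or>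
       J = (\<lambda>i. c - i) ` I \<and> (\<forall>i\<in>I. g (c - i) = f i)"
      by (cases p; cases q) (auto simp: same_curve_iff)
    then consider "J = (\<lambda>i. c + i) ` I" "\<forall>i\<in>I. g (c + i) = f i"
      | "J = (\<lambda>i. c - i) ` I" "\<forall>i\<in>I. g (c - i) = f i" by blast
    then show "(q, p) \<in> same_curve"
    proof cases
      case 1
      then have "I = (\<lambda>i. - c + i) ` J \<and> (\<forall>i\<in>J. f (- c + i) = g i)"
        by (auto simp: image_image)
      then show ?thesis unfolding pq same_curve_iff by blast
    next
      case 2
      then have "I = (\<lambda>i. c - i) ` J \<and> (\<forall>i\<in>J. f (c - i) = g i)"
        by (auto simp: image_image)
      then show ?thesis unfolding pq same_curve_iff by blast
    qed
  qed
  show "trans ?S"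
  proof (rule transI)
    fix p q r :: "'n segseq"
    assume pq: "(p, q) \<in> same_curve" and qr: "(q, r) \<in> same_curve"
    obtain I f J g K h where [simp]: "p = (I, f)" "q = (J, g)" "r = (K, h)"
      by (cases p; cases q; cases r) auto
    have shift: "(p, r) \<in> same_curve" if "K = (\<lambda>i. c + i) ` I" "\<forall>i\<in>I. h (c + i) = f i" for c
      using that by (auto simp: same_curve_iff)
    have reverse: "(p, r) \<in> same_curve" if "K = (\<lambda>i. c - i) ` I" "\<forall>i\<in>I. h (c - i) = f i" for c
      using that by (auto simp: same_curve_iff)
    from pq qr consider
        c d where "J = (\<lambda>i. c + i) ` I" "\<forall>i\<in>I. g (c + i) = f i"
          "K = (\<lambda>i. d + i) ` J" "\<forall>i\<in>J. h (d + i) = g i"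
      | c d where "J = (\<lambda>i. c + i) ` I" "\<forall>i\<in>I. g (c + i) = f i"
          "K = (\<lambda>i. d - i) ` J" "\<forall>i\<in>J. h (d - i) = g i"
      | c d where "J = (\<lambda>i. c - i) ` I" "\<forall>i\<in>I. g (c - i) = f i"
          "K = (\<lambda>i. d + i) ` J" "\<forall>i\<in>J. h (d + i) = g i"
      | c d where "J = (\<lambda>i. c - i) ` I" "\<forall>i\<in>I. g (c - i) = f i"
          "K = (\<lambda>i. d - i) ` J" "\<forall>i\<in>J. h (d - i) = g i"
      by (simp only: \<open>p = _\<close> \<open>q = _\<close> \<open>r = _\<close> same_curve_iff) blast
    then show "(p, r) \<in> same_curve"
    proof cases
      case (1 c d)
      show ?thesis by (rule shift[of "d + c"]) (use 1 in \<open>auto simp: image_image algebra_simps\<close>)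
    next
      case (2 c d)
      show ?thesis by (rule reverse[of "d - c"]) (use 2 in \<open>auto simp: image_image algebra_simps\<close>)
    next
      case (3 c d)
      show ?thesis by (rule reverse[of "d + c"]) (use 3 in \<open>auto simp: image_image algebra_simps\<close>)
    next
      case (4 c d)
      show ?thesis by (rule shift[of "d - c"]) (use 4 in \<open>auto simp: image_image algebra_simps\<close>)
    qed
  qed
qed

lemma curve_of_eq_iff: "curve_of p = curve_of q \<longleftrightarrow> (p, q) \<in> same_curve"
  unfolding curve_of_def by (simp add: eq_equiv_class_iff[OF equiv_same_curve])

lemma mem_curve_of: "q \<in> curve_of p \<longleftrightarrow> curve_of q = curve_of p"
  unfolding curve_of_eq_iff using equiv_same_curve by (auto simp: curve_of_def elim: equivE symE)

lemma curve_of_cong: "(\<And>i. i \<in> I \<Longrightarrow> f i = g i) \<Longrightarrow> curve_of (I, f) = curve_of (I, g)"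
  unfolding curve_of_eq_iff same_curve_iff by (intro disjI1 exI[of _ 0]) auto

lemma curve_of_shift: "curve_of ((\<lambda>i. c + i) ` I, f) = curve_of (I, \<lambda>i. f (c + i))"
  by (rule sym) (auto simp: curve_of_eq_iff same_curve_iff)

lemma segments_of_curve_of: "segments_of (curve_of (I, f)) = f ` I"
proof -
  have image: "g ` J = f ` I" if "(J, g) \<in> curve_of (I, f)" for J g
    using that by (auto simp: curve_of_def same_curve_iff image_image)
  show ?thesis
  proof (intro equalityI subsetI)
    fix s assume "s \<in> segments_of (curve_of (I, f))"
    then obtain J g where "(J, g) \<in> curve_of (I, f)" "s \<in> g ` J"
      by (auto simp: segments_of_def)
    then show "s \<in> f ` I" using image by blast
  next
    fix s assume "s \<in> f ` I"
    moreover have "(I, f) \<in> curve_of (I, f)" by (simp add: mem_curve_of)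
    ultimately show "s \<in> segments_of (curve_of (I, f))"
      unfolding segments_of_def by (rule_tac UN_I[of "(I, f)"]) simp_all
  qed
qed

text \<open>A curve contains the reversals of its sequences, so quantifying over all of them amounts
  to fixing any one and allowing both orders of the two segments. This frees
  \<open>connected_in\<close> from the choice of a representative.\<close>

lemma consecutive_curve_of_iff:
  "(\<exists>(J, g)\<in>curve_of (I, f). \<exists>i. i \<in> J \<and> i + 1 \<in> J \<and> s = g i \<and> t = g (i + 1)) \<longleftrightarrow>
   (\<exists>i. i \<in> I \<and> i + 1 \<in> I \<and> (s = f i \<and> t = f (i + 1) \<or> t = f i \<and> s = f (i + 1)))"
    (is "?L \<longleftrightarrow> ?R")
proof
  assume ?L
  then obtain J g i where g: "(J, g) \<in> curve_of (I, f)" "i \<in> J" "i + 1 \<in> J" "s = g i" "t = g (i + 1)"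
    by auto
  then consider c where "J = (\<lambda>i. c + i) ` I" "\<forall>i\<in>I. g (c + i) = f i"
    | c where "J = (\<lambda>i. c - i) ` I" "\<forall>i\<in>I. g (c - i) = f i"
    by (auto simp: curve_of_def same_curve_iff)
  then show ?R
  proof cases
    case (1 c)
    then obtain a b where "a \<in> I" "i = c + a" "b \<in> I" "i + 1 = c + b" using g(2,3) by blast
    moreover from this have "b = a + 1" by simp
    ultimately show ?R using 1(2) g(4,5) by (metis add.assoc)
  next
    case (2 c)
    then obtain a b where "a \<in> I" "i = c - a" "b \<in> I" "i + 1 = c - b" using g(2,3) by blast
    moreover from this have "a = b + 1" by simp
    ultimately show ?R using 2(2) g(4,5) by metis
  qed
next
  assume ?R
  then obtain i where i: "i \<in> I" "i + 1 \<in> I"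
    "s = f i \<and> t = f (i + 1) \<or> t = f i \<and> s = f (i + 1)" by blast
  from i(3) show ?L
  proof
    assume "s = f i \<and> t = f (i + 1)"
    moreover have "(I, f) \<in> curve_of (I, f)" by (simp add: mem_curve_of)
    ultimately show ?L using i(1,2) by blast
  next
    assume *: "t = f i \<and> s = f (i + 1)"
    have "(uminus ` I, \<lambda>i. f (- i)) \<in> curve_of (I, f)"
      unfolding curve_of_def Image_singleton_iff same_curve_iff by (intro disjI2 exI[of _ 0]) auto
    \<comment> \<open>Negation sends the indices \<open>i\<close>, \<open>i + 1\<close> to
      \<open>- i\<close>, \<open>- i - 1\<close>, so the consecutive pair now starts at
      \<open>- i - 1\<close>.\<close>
    moreover have "- i - 1 \<in> uminus ` I" by (rule image_eqI[OF _ i(2)]) simp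
    moreover have "- i - 1 + 1 \<in> uminus ` I" by (rule image_eqI[OF _ i(1)]) simp
    moreover have "s = f (- (- i - 1)) \<and> t = f (- (- i - 1 + 1))" using * by (simp add: add.commute)
    ultimately show ?L by (intro bexI[of _ "(uminus ` I, \<lambda>i. f (- i))"]) blast+
  qed
qed

lemma connected_inI:
  assumes "curve_of (I, f) \<in> \<E>" "i \<in> I" "i + 1 \<in> I"
    "s = f i \<and> t = f (i + 1) \<or> t = f i \<and> s = f (i + 1)"
  shows "connected_in \<E> s t"
  unfolding connected_in_def
  by (rule bexI[OF _ assms(1)], unfold consecutive_curve_of_iff) (use assms(2-) in blast)

text \<open>The representative stays universally quantified in the conclusion, so that each use can
  insert the one it has at hand: a vertex path, or the sequence produced by a convolution.\<close>

lemma connected_inE: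
  assumes "connected_in \<E> s t"
  obtains C where "C \<in> \<E>" "\<And>I f. C = curve_of (I, f) \<Longrightarrow>
     \<exists>i. i \<in> I \<and> i + 1 \<in> I \<and> (s = f i \<and> t = f (i + 1) \<or> t = f i \<and> s = f (i + 1))"
proof -
  obtain C where C: "C \<in> \<E>"
    "\<exists>(I, f)\<in>C. \<exists>i. i \<in> I \<and> i + 1 \<in> I \<and> s = f i \<and> t = f (i + 1)"
    using assms unfolding connected_in_def by blast
  from C(1) show thesis
  proof (rule that)
    fix I f assume "C = curve_of (I, f)"
    with C(2) show "\<exists>i. i \<in> I \<and> i + 1 \<in> I \<and> (s = f i \<and> t = f (i + 1) \<or> t = f i \<and> s = f (i + 1))"
      by (simp only: consecutive_curve_of_iff)
  qed
qed

section \<open>Finite curves as vertex sequences\<close>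

text \<open>Encoding a finite curve by its vertices makes its two endpoints, \<open>w 0\<close> and
  \<open>w N\<close>, directly accessible once the index set is normalized to
  \<open>{0..<N}\<close>.\<close>

definition edge :: "(int \<Rightarrow> int ^ 'n::finite) \<Rightarrow> int \<Rightarrow> 'n segment" where
  "edge w i = {w i, w (i + 1)}"

lemma curve_of_edge_reverse:
  "curve_of ({0..<N}, edge (\<lambda>i. w (N - i))) = curve_of ({0..<N}, edge w)"
proof -
  have "(({0..<N}, edge w), ({0..<N}, edge (\<lambda>i. w (N - i)))) \<in> same_curve"
    unfolding same_curve_iff
  \<comment> \<open>Vertices are reversed by \<open>i \<mapsto> N - i\<close>, but edges by
    \<open>i \<mapsto> N - 1 - i\<close>, since edge \<open>i\<close> lies between the vertices
    \<open>i\<close> and \<open>i + 1\<close>.\<close>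
  proof (intro disjI2 exI[of _ "N - 1"] conjI)
    show "{0..<N} = (\<lambda>i. N - 1 - i) ` {0..<N}"
      by (auto intro!: image_eqI[of _ _ "N - 1 - _"])
  qed (auto simp: edge_def algebra_simps)
  then show ?thesis by (simp add: curve_of_eq_iff[symmetric])
qed

lemma leads_shift:
  assumes "leads f a b p q"
  obtains w where "w 0 = p" "w (b - a) = q" "curve_of ({a..<b}, f) = curve_of ({0..<b - a}, edge w)"
    "\<And>i. i \<in> {0..<b - a} \<Longrightarrow> f (a + i) = edge w i"
proof -
  obtain v where v: "v a = p" "v b = q" "\<forall>i\<in>{a..<b}. f i = {v i, v (i + 1)}"
    using assms by (auto simp: leads_def)
  have "curve_of ({a..<b}, f) = curve_of ((\<lambda>i. a + i) ` {0..<b - a}, f)" by simp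
  also have "\<dots> = curve_of ({0..<b - a}, \<lambda>i. f (a + i))" by (rule curve_of_shift)
  also have "\<dots> = curve_of ({0..<b - a}, edge (\<lambda>i. v (a + i)))"
    using v by (intro curve_of_cong) (auto simp: edge_def add.assoc)
  finally show thesis using v by (intro that[of "\<lambda>i. v (a + i)"]) (auto simp: edge_def add.assoc)
qed

lemma joins_iff:
  assumes "C \<in> curves"
  shows "joins C p q \<longleftrightarrow>
    (\<exists>N w. 0 < N \<and> C = curve_of ({0..<N}, edge w) \<and> w 0 = p \<and> w N = q)"
proof
  assume "joins C p q"
  then obtain f a b where f: "({a..<b}, f) \<in> C" "leads f a b p q" by (auto simp: joins_def)
  from f(1) assms have "C = curve_of ({a..<b}, f)" by (auto simp: curves_def mem_curve_of)
  moreover have "a < b" using f by (simp add: leads_def)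
  ultimately show "\<exists>N w. 0 < N \<and> C = curve_of ({0..<N}, edge w) \<and> w 0 = p \<and> w N = q"
    using leads_shift[OF f(2)] by (metis diff_gt_0_iff_gt)
next
  assume "\<exists>N w. 0 < N \<and> C = curve_of ({0..<N}, edge w) \<and> w 0 = p \<and> w N = q"
  then obtain N w where "0 < N" "C = curve_of ({0..<N}, edge w)" "w 0 = p" "w N = q" by auto
  then show "joins C p q" unfolding joins_def leads_def
    by (intro exI[of _ "edge w"] exI[of _ 0] exI[of _ N])
      (auto simp: mem_curve_of edge_def intro!: exI[of _ w])
qed

lemma edge_Int:
  assumes "edge w i \<noteq> edge w (i + 1)"
  shows "edge w i \<inter> edge w (i + 1) = {w (i + 1)}"
  using assms by (auto simp: edge_def add.assoc)

text \<open>An interior vertex is the only common point of two consecutive distinct edges, hence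
  determined by the edges, and the two end vertices follow. The reversed alternative is there for
  \<open>N = 1\<close>, where a single segment can be traversed both ways.\<close>

lemma vertices_unique:
  assumes "0 < N" "inj_on (edge w) {0..<N}" "\<And>i. i \<in> {0..<N} \<Longrightarrow> edge w i = edge w' i"
  shows "(\<forall>i\<in>{0..N}. w' i = w i) \<or> (\<forall>i\<in>{0..N}. w' i = w (N - i))"
proof (cases "N = 1")
  case True
  then have *: "{0..N} = {0, 1}" by auto
  show ?thesis unfolding * using assms(3)[of 0] True by (auto simp: edge_def doubleton_eq_iff)
next
  case False
  have mid: "w' i = w i" if "0 < i" "i < N" for i
  proof -
    have "edge w (i - 1) \<noteq> edge w i" using inj_onD[OF assms(2), of "i - 1" i] that by auto
    then have "edge w (i - 1) \<inter> edge w i = {w i}" using edge_Int[of w "i - 1"] by simp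
    moreover have "w' i \<in> edge w' (i - 1) \<inter> edge w' i" by (simp add: edge_def)
    ultimately show ?thesis using assms(3)[of i] assms(3)[of "i - 1"] that by auto
  qed
  have "w' 0 = w 0" using assms(1) assms(3)[of 0] mid[of 1] False
    by (auto simp: edge_def doubleton_eq_iff)
  moreover have "w' N = w N" using assms(1) assms(3)[of "N - 1"] mid[of "N - 1"] False
    by (auto simp: edge_def doubleton_eq_iff)
  ultimately show ?thesis using mid by (metis atLeastAtMost_iff order_le_less)
qed

lemma atLeastLessThan_int_eq:
  fixes c N N' :: int
  assumes "{0..<N'} = {c..<c + N}" "0 < N"
  shows "c = 0 \<and> N' = N"
proof -
  have "c \<in> {0..<N'}" unfolding assms(1) using assms(2) by simp
  then have "0 < N'" by simp
  then show ?thesis using assms atLeastLessThan_eq_iff[of 0 N' c "c + N"] by simp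
qed

text \<open>Two representatives differ by a shift or a reversal of indices; as both index sets start
  at 0, only the identity and \<open>i \<mapsto> N - 1 - i\<close> remain. The vertices are then
  recovered from the edges.\<close>

lemma path_unique:
  assumes eq: "curve_of ({0..<N}, edge w) = curve_of ({0..<N'}, edge w')"
    and N: "0 < N" and inj: "inj_on (edge w) {0..<N}"
  shows "N' = N \<and> ((\<forall>i\<in>{0..N}. w' i = w i) \<or> (\<forall>i\<in>{0..N}. w' i = w (N - i)))"
proof -
  from eq consider c where "{0..<N'} = (\<lambda>i. c + i) ` {0..<N}" "\<forall>i\<in>{0..<N}. edge w' (c + i) = edge w i"
    | c where "{0..<N'} = (\<lambda>i. c - i) ` {0..<N}" "\<forall>i\<in>{0..<N}. edge w' (c - i) = edge w i"
    by (auto simp: curve_of_eq_iff same_curve_iff)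
  then show ?thesis
  proof cases
    case (1 c)
    then have "{0..<N'} = {c..<c + N}" by (simp add: add.commute)
    then have "c = 0" "N' = N" using N atLeastLessThan_int_eq by blast+
    then show ?thesis using vertices_unique[OF N inj, of w'] 1 by simp
  next
    case (2 c)
    have "(\<lambda>i. c - i) ` {0..<N} = {c - N + 1..<c + 1}"
      by (auto intro!: image_eqI[of _ _ "c - _"])
    with 2 have "{0..<N'} = {c - N + 1..<(c - N + 1) + N}" by simp
    then have "c - N + 1 = 0 \<and> N' = N" using N atLeastLessThan_int_eq by blast
    then have [simp]: "c = N - 1" "N' = N" by auto
    have "edge w i = edge (\<lambda>i. w' (N - i)) i" if "i \<in> {0..<N}" for i
    proof -
      have "edge w' (N - 1 - i) = edge w i" using 2(2) that by simp
      then show ?thesis by (simp add: edge_def insert_commute algebra_simps)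
    qed
    from vertices_unique[OF N inj this]
    show ?thesis
    proof
      assume *: "\<forall>i\<in>{0..N}. w' (N - i) = w i"
      have "w' i = w (N - i)" if "i \<in> {0..N}" for i using *[rule_format, of "N - i"] that by simp
      then show ?thesis by simp
    next
      assume *: "\<forall>i\<in>{0..N}. w' (N - i) = w (N - i)"
      have "w' i = w i" if "i \<in> {0..N}" for i using *[rule_format, of "N - i"] that by simp
      then show ?thesis by simp
    qed
  qed
qed

lemma leads_trans:
  assumes "leads f a b p q" "leads f b c q r"
  shows "leads f a c p r"
proof -
  obtain v where v: "v a = p" "v b = q" "\<forall>i\<in>{a..<b}. f i = {v i, v (i + 1)}"
    using assms by (auto simp: leads_def)
  obtain v' where v': "v' b = q" "v' c = r" "\<forall>i\<in>{b..<c}. f i = {v' i, v' (i + 1)}"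
    using assms by (auto simp: leads_def)
  have "a < b" "b < c" using assms by (auto simp: leads_def)
  \<comment> \<open>The seam of the two vertex sequences: the edge with index \<open>b - 1\<close>
    ends at \<open>b\<close>, where both take the value \<open>q\<close>.\<close>
  moreover have "v' (i + 1) = v (i + 1)" if "i < b" "\<not> i + 1 < b" for i
  proof -
    have "i + 1 = b" using that by simp
    then show ?thesis using v(2) v'(1) by simp
  qed
  ultimately show ?thesis unfolding leads_def using v v'
    by (intro conjI exI[of _ "\<lambda>i. if i < b then v i else v' i"]) auto
qed

lemma translate_curve_of:
  "translate_curve w (curve_of (I, f)) = curve_of (I, \<lambda>i. translate_seg w (f i))"
proof -
  have *: "(J, \<lambda>i. translate_seg w (g i)) \<in> curve_of (I, \<lambda>i. translate_seg w (f i))"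
    if "(J, g) \<in> curve_of (I, f)" for J g f and w :: "int ^ 'n"
    using that unfolding curve_of_def Image_singleton_iff same_curve_iff by metis
  show ?thesis
  proof
    show "translate_curve w (curve_of (I, f)) \<subseteq> curve_of (I, \<lambda>i. translate_seg w (f i))"
      using * by (auto simp: translate_curve_def)
    show "curve_of (I, \<lambda>i. translate_seg w (f i)) \<subseteq> translate_curve w (curve_of (I, f))"
    proof
      fix p assume p: "p \<in> curve_of (I, \<lambda>i. translate_seg w (f i))"
      obtain J g where [simp]: "p = (J, g)" by (cases p)
      have "(J, \<lambda>i. translate_seg (- w) (g i)) \<in> curve_of (I, f)"
        using *[of J g "\<lambda>i. translate_seg w (f i)" "- w"] p
        by (simp add: translate_seg_add translate_seg_0)
      then show "p \<in> translate_curve w (curve_of (I, f))" unfolding translate_curve_def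
        by (rule rev_image_eqI) (simp add: translate_seg_add translate_seg_0)
    qed
  qed
qed

section \<open>Curves joining dilated neighbours\<close>

text \<open>The part of (H) that governs how curves meet the points of the dilated lattice; the
  translations are added in \<open>periodic_covering\<close>.\<close>

locale H_covering =
  fixes k :: nat and \<A> :: "'n::finite curve set"
  assumes k_pos: "0 < k"
    and covering: "covering \<A>"
    and ends: "C \<in> \<A> \<Longrightarrow> \<exists>x\<in>multiples k. \<exists>i. joins C x (x + axis i (int k))"
    and unique_join: "x \<in> multiples k \<Longrightarrow> \<exists>!C. C \<in> \<A> \<and> joins C x (x + axis i (int k))"
begin

definition joining :: "'n curve \<Rightarrow> int \<Rightarrow> (int \<Rightarrow> int ^ 'n) \<Rightarrow> int ^ 'n \<Rightarrow> int ^ 'n \<Rightarrow> bool" where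
  "joining C N w q r \<longleftrightarrow> C \<in> \<A> \<and> 0 < N \<and> C = curve_of ({0..<N}, edge w) \<and>
     w 0 = int k *s q \<and> w N = int k *s r"

text \<open>The order of the arguments matters: this is the segment at k q of the curve that
  replaces [q, r], while \<open>end_seg r q\<close> concerns its other end, at k r.\<close>

definition end_seg :: "int ^ 'n \<Rightarrow> int ^ 'n \<Rightarrow> 'n segment \<Rightarrow> bool" where
  "end_seg q r u \<longleftrightarrow> (\<exists>C N w. joining C N w q r \<and> u = edge w 0)"

lemma curves: "C \<in> \<A> \<Longrightarrow> C \<in> curves"
  using covering by (auto simp: covering_def)

lemma dilate_inj: "int k *s q = int k *s r \<longleftrightarrow> q = r"
  using k_pos by (auto simp: vec_eq_iff)

lemma dilate_axis: "int k *s (q + axis i 1) = int k *s q + axis i (int k)"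
  by (auto simp: vec_eq_iff axis_def distrib_left)

lemma dilate_multiples: "int k *s q \<in> multiples k"
  by (auto simp: multiples_def)

lemma joins_iff_path: "C \<in> \<A> \<and> joins C (int k *s q) (int k *s r) \<longleftrightarrow> (\<exists>N w. joining C N w q r)"
  unfolding joining_def using joins_iff[OF curves, of C] by blast

lemma joiningD:
  assumes "joining C N w q r"
  shows "C \<in> \<A>" "0 < N" "C = curve_of ({0..<N}, edge w)" "curve_of ({0..<N}, edge w) \<in> \<A>"
    "w 0 = int k *s q" "w N = int k *s r"
  using assms unfolding joining_def by metis+

lemma path_reverse: "joining C N w q r \<Longrightarrow> joining C N (\<lambda>i. w (N - i)) r q"
  by (auto simp: joining_def curve_of_edge_reverse)

text \<open>(H) speaks only of the direction from x to \<open>x + axis i k\<close>; reversing paths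
  covers the opposite one, so that q and r become interchangeable.\<close>

lemma path_exists_unique_curve:
  assumes "{q, r} \<in> segments"
  shows "\<exists>!C. \<exists>N w. joining C N w q r"
proof -
  have *: "\<exists>!C. \<exists>N w. joining C N w q (q + axis i 1)" for q i
    unfolding joins_iff_path[symmetric] dilate_axis by (rule unique_join[OF dilate_multiples])
  obtain z i where "{q, r} = {z, z + axis i 1}" using assms by (auto simp: segments_def)
  then consider "r = q + axis i 1" | "q = r + axis i 1" by (auto simp: doubleton_eq_iff)
  then show ?thesis
  proof cases
    case 2
    have "(\<exists>N w. joining C N w q r) \<longleftrightarrow> (\<exists>N w. joining C N w r q)" for C
      using path_reverse by blast
    with * 2 show ?thesis by simp
  qed (use * in simp)
qed

lemma obtain_path:
  assumes "C \<in> \<A>"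
  obtains N w q r where "joining C N w q r" "{q, r} \<in> segments"
proof -
  obtain q i where "joins C (int k *s q) (int k *s q + axis i (int k))"
    using ends[OF assms] by (auto simp: multiples_def)
  then obtain N w where "joining C N w q (q + axis i 1)"
    using assms joins_iff_path unfolding dilate_axis[symmetric] by blast
  moreover have "{q, q + axis i 1} \<in> segments" by (auto simp: segments_def)
  ultimately show thesis using that by blast
qed

lemma path_inj: "joining C N w q r \<Longrightarrow> inj_on (edge w) {0..<N}"
  using covering mem_curve_of[of "({0..<N}, edge w)" "({0..<N}, edge w)"]
  by (fastforce simp: joining_def covering_def self_avoiding_def)

lemma segments_of_subset: "C \<in> \<A> \<Longrightarrow> segments_of C \<subseteq> segments"
  using curves by (force simp: curves_def curve_seq_def segments_of_curve_of)

lemma path_segments_of: "joining C N w q r \<Longrightarrow> segments_of C = edge w ` {0..<N}"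
  by (auto simp: joining_def segments_of_curve_of)

lemma path_segments: "joining C N w q r \<Longrightarrow> i \<in> {0..<N} \<Longrightarrow> edge w i \<in> segments"
  using segments_of_subset[of C] path_segments_of[of C N w q r] joiningD(1)[of C N w q r]
  by blast

lemma curve_eqI:
  assumes "C \<in> \<A>" "C' \<in> \<A>" "u \<in> segments_of C" "u \<in> segments_of C'"
  shows "C = C'"
  using assms covering segments_of_subset[of C] unfolding covering_def by blast

lemma obtain_curve:
  assumes "u \<in> segments"
  obtains C where "C \<in> \<A>" "u \<in> segments_of C"
  using assms covering by (auto simp: covering_def)

lemma same_path:
  assumes "joining C N w q r" "joining C N' w' q' r'"
  shows "N' = N \<and> ((\<forall>i\<in>{0..N}. w' i = w i) \<or> (\<forall>i\<in>{0..N}. w' i = w (N - i)))"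
  using assms path_inj[OF assms(1)] by (intro path_unique) (auto simp: joining_def)

lemma end_seg_exists: "{q, r} \<in> segments \<Longrightarrow> \<exists>u. end_seg q r u"
  using path_exists_unique_curve[of q r] unfolding end_seg_def by blast

lemma end_seg_mem:
  assumes "end_seg q r u"
  shows "int k *s q \<in> u" "u \<in> segments"
proof -
  obtain C N w where *: "joining C N w q r" "u = edge w 0" using assms by (auto simp: end_seg_def)
  moreover from this have "0 < N" by (simp add: joining_def)
  ultimately show "int k *s q \<in> u" "u \<in> segments"
    using path_segments[OF *(1), of 0] by (auto simp: joining_def edge_def)
qed

text \<open>The curve between k q and k r is unique, and of its two traversals only one starts at k
  q because the two endpoints differ.\<close>

lemma end_seg_unique:
  assumes "end_seg q r u" "end_seg q r u'" "{q, r} \<in> segments"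
  shows "u = u'"
proof -
  obtain C N w where p: "joining C N w q r" "u = edge w 0" using assms(1) by (auto simp: end_seg_def)
  obtain C' N' w' where p': "joining C' N' w' q r" "u' = edge w' 0"
    using assms(2) by (auto simp: end_seg_def)
  have "C' = C" using path_exists_unique_curve[OF assms(3)] p p' by blast
  then have eq: "N' = N" "(\<forall>i\<in>{0..N}. w' i = w i) \<or> (\<forall>i\<in>{0..N}. w' i = w (N - i))"
    using same_path[OF p(1)] p'(1) by blast+
  have N: "0 < N" using p by (simp add: joining_def)
  have "w N \<noteq> w 0" using joiningD(5,6)[OF p(1)] segment_neq[OF assms(3)] dilate_inj by metis
  moreover have "w' 0 = w 0" using p p' by (auto simp: joining_def)
  ultimately have "w' 0 \<noteq> w (N - 0)" by simp
  then have "\<forall>i\<in>{0..N}. w' i = w i" using eq(2) N by fastforce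
  then show ?thesis using p p' N by (auto simp: edge_def)
qed

text \<open>Two curves of a covering with a common segment coincide, so the two traversals are equal
  or opposite. If opposite, \<open>u\<close> is both the first and the last edge, so the curve is a
  single segment; both traversals would start at k q, although its endpoints differ.\<close>

lemma end_seg_inj:
  assumes "end_seg q r u" "end_seg q r' u"
  shows "r = r'"
proof -
  obtain C N w where p: "joining C N w q r" "u = edge w 0" using assms(1) by (auto simp: end_seg_def)
  obtain C' N' w' where p': "joining C' N' w' q r'" "u = edge w' 0"
    using assms(2) by (auto simp: end_seg_def)
  have N: "0 < N" "0 < N'" using p p' by (auto simp: joining_def)
  then have "C' = C" using p p' path_segments_of[OF p(1)] path_segments_of[OF p'(1)]
    by (intro curve_eqI[of _ _ u]) (auto simp: joining_def)
  then have eq: "N' = N" "(\<forall>i\<in>{0..N}. w' i = w i) \<or> (\<forall>i\<in>{0..N}. w' i = w (N - i))"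
    using same_path[OF p(1)] p'(1) by blast+
  from eq(2) show ?thesis
  proof
    assume "\<forall>i\<in>{0..N}. w' i = w i"
    then have "w' N' = w N" using N eq(1) by simp
    then show ?thesis using p(1) p'(1) dilate_inj[of r r'] by (simp add: joining_def)
  next
    assume *: "\<forall>i\<in>{0..N}. w' i = w (N - i)"
    then have "edge w' 0 = edge w (N - 1)" using N by (auto simp: edge_def)
    then have "N - 1 = 0" using p(2) p'(2) N inj_onD[OF path_inj[OF p(1)], of 0 "N - 1"] by auto
    then have "N = 1" by simp
    have "w' 0 = w 0" using p p' by (simp add: joining_def)
    moreover have "w' 0 = w 1" using * \<open>N = 1\<close> by auto
    moreover have "w 0 \<noteq> w 1" using path_segments[OF p(1), of 0] \<open>N = 1\<close> segment_neq
      by (auto simp: edge_def)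
    ultimately show ?thesis by simp
  qed
qed

text \<open>There are as many segments at \<open>k q\<close> as curves of \<open>\<A>\<close> with endpoint \<open>k q\<close>, and different
  curves have different end segments.\<close>
lemma end_seg_surj:
  assumes "u \<in> segments" "int k *s q \<in> u"
  obtains r where "{q, r} \<in> segments" "end_seg q r u"
proof -
  have "\<exists>d\<in>unit_vectors. end_seg q (q + e) {int k *s q, int k *s q + d}" if e: "e \<in> unit_vectors" for e
  proof -
    have "{q, q + e} \<in> segments" using e by (simp add: segments_iff)
    then obtain v where v: "end_seg q (q + e) v" using end_seg_exists by blast
    then obtain y where y: "v = {int k *s q, y}" using segment_cases end_seg_mem by metis
    then have "y - int k *s q \<in> unit_vectors" using end_seg_mem(2)[OF v] by (simp add: segments_iff)
    then show ?thesis using v y by (intro bexI[of _ "y - int k *s q"]) auto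
  qed
  then obtain h where h: "\<And>e. e \<in> unit_vectors \<Longrightarrow> h e \<in> unit_vectors \<and>
      end_seg q (q + e) {int k *s q, int k *s q + h e}" by metis
  have "inj_on h unit_vectors" using h end_seg_inj by (intro inj_onI) (metis add_left_cancel)
  moreover have "h ` unit_vectors \<subseteq> unit_vectors" using h by blast
  ultimately have surj: "h ` unit_vectors = unit_vectors"
    by (simp add: endo_inj_surj finite_unit_vectors)
  obtain y where y: "u = {int k *s q, y}" using segment_cases assms by metis
  then have "y - int k *s q \<in> h ` unit_vectors" using assms(1) surj by (simp add: segments_iff)
  then obtain e where e: "e \<in> unit_vectors" "y - int k *s q = h e" by blast
  then have "u = {int k *s q, int k *s q + h e}" using y by (simp add: e(2)[symmetric])
  then show thesis using that[of "q + e"] h e by (simp add: segments_iff)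
qed

section \<open>Connexions inside the curves of the covering\<close>

lemma obtain_connected_path:
  assumes "connected_in \<A> s t"
  obtains C N w q r i where "joining C N w q r" "{q, r} \<in> segments" "0 \<le> i" "i + 1 < N"
    "s = edge w i \<and> t = edge w (i + 1) \<or> t = edge w i \<and> s = edge w (i + 1)"
proof -
  obtain C where C: "C \<in> \<A>" "\<And>I f. C = curve_of (I, f) \<Longrightarrow>
     \<exists>i. i \<in> I \<and> i + 1 \<in> I \<and> (s = f i \<and> t = f (i + 1) \<or> t = f i \<and> s = f (i + 1))"
    using assms by (rule connected_inE) blast
  obtain N w q r where p: "joining C N w q r" "{q, r} \<in> segments" using obtain_path[OF C(1)] by blast
  then obtain i where "i \<in> {0..<N}" "i + 1 \<in> {0..<N}"
    "s = edge w i \<and> t = edge w (i + 1) \<or> t = edge w i \<and> s = edge w (i + 1)"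
    using C(2)[of "{0..<N}" "edge w"] by (auto simp: joining_def)
  then show thesis using that p by auto
qed

lemma connected_sym:
  assumes "connected_in \<A> s t"
  shows "connected_in \<A> t s"
proof -
  obtain C N w q r i where *: "joining C N w q r" "{q, r} \<in> segments" "0 \<le> i" "i + 1 < N"
    "s = edge w i \<and> t = edge w (i + 1) \<or> t = edge w i \<and> s = edge w (i + 1)"
    using obtain_connected_path[OF assms] .
  show ?thesis by (rule connected_inI[OF joiningD(4)[OF *(1)], of i]) (use *(3-) in auto)
qed

lemma path_edge_Int:
  assumes "joining C N w q r" "0 \<le> i" "i + 1 < N"
  shows "edge w i \<noteq> edge w (i + 1)" "edge w i \<inter> edge w (i + 1) = {w (i + 1)}"
proof -
  show "edge w i \<noteq> edge w (i + 1)"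
    using inj_onD[OF path_inj[OF assms(1)], of i "i + 1"] assms by auto
  then show "edge w i \<inter> edge w (i + 1) = {w (i + 1)}" by (rule edge_Int)
qed

lemma connected_Int:
  assumes "connected_in \<A> s t"
  shows "s \<in> segments" "t \<in> segments" "\<exists>p. s \<inter> t = {p}"
proof -
  obtain C N w q r i where *: "joining C N w q r" "{q, r} \<in> segments" "0 \<le> i" "i + 1 < N"
    "s = edge w i \<and> t = edge w (i + 1) \<or> t = edge w i \<and> s = edge w (i + 1)"
    using obtain_connected_path[OF assms] .
  then show "s \<in> segments" "t \<in> segments" using path_segments[OF *(1)] by auto
  show "\<exists>p. s \<inter> t = {p}" using * path_edge_Int(2)[OF *(1,3,4)] by (auto simp: Int_commute)
qed

text \<open>Suppose a curve passes through k q in its interior, arriving along the edge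
  \<open>u\<close>. By \<open>end_seg_surj\<close>, \<open>u\<close> is also the first edge of a
  curve leaving k q, which must be the same curve. So \<open>u\<close> is its first or its last
  edge. In the first case the curve starts at k q and \<open>u\<close> would have both endpoints
  there; in the second no edge follows \<open>u\<close>.\<close>

lemma not_connected_at_multiple:
  assumes "connected_in \<A> s t" "int k *s q \<in> s" "int k *s q \<in> t"
  shows False
proof -
  obtain C N w q' r' i where *: "joining C N w q' r'" "{q', r'} \<in> segments" "0 \<le> i" "i + 1 < N"
    "s = edge w i \<and> t = edge w (i + 1) \<or> t = edge w i \<and> s = edge w (i + 1)"
    using obtain_connected_path[OF assms(1)] .
  note * = *(1,3-)
  have kq: "w (i + 1) = int k *s q" using path_edge_Int(2)[OF *(1-3)] *(4) assms(2,3)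
    by (metis IntI singletonD)
  define u where "u = edge w i"
  have u: "u \<in> segments_of C" "u \<in> segments"
    using path_segments_of[OF *(1)] path_segments[OF *(1), of i] *(2,3) by (auto simp: u_def)
  obtain r where "end_seg q r u" using end_seg_surj[of u q] u kq by (auto simp: u_def edge_def)
  then obtain C' N' w' where p': "joining C' N' w' q r" "u = edge w' 0" by (auto simp: end_seg_def)
  have "C' = C" using u p' path_segments_of[OF p'(1)] *(1)
    by (intro curve_eqI[of _ _ u]) (auto simp: joining_def)
  then have eq: "N' = N" "(\<forall>i\<in>{0..N}. w' i = w i) \<or> (\<forall>i\<in>{0..N}. w' i = w (N - i))"
    using same_path[OF *(1)] p'(1) by blast+
  from eq(2) show False
  proof
    assume "\<forall>i\<in>{0..N}. w' i = w i"
    then have w': "w' 0 = w 0" "w' 1 = w 1" using *(2,3) by auto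
    then have "edge w i = edge w 0" using p'(2) by (simp add: u_def edge_def)
    then have "i = 0" using inj_onD[OF path_inj[OF *(1)], of i 0] *(2,3) by auto
    then have "w 1 = w 0" using kq w' p'(1) by (simp add: joining_def)
    then show False using u(2) \<open>i = 0\<close> segment_neq[of "w 0" "w 1"] by (simp add: u_def edge_def)
  next
    assume "\<forall>i\<in>{0..N}. w' i = w (N - i)"
    then have "w' 0 = w N" "w' 1 = w (N - 1)" using *(2,3) by auto
    then have "edge w i = edge w (N - 1)" using p'(2) by (auto simp: u_def edge_def)
    then have "i = N - 1" using inj_onD[OF path_inj[OF *(1)], of i "N - 1"] *(2,3) by auto
    then show False using *(3) by simp
  qed
qed

text \<open>A segment of a finite path has a neighbour at each of its endpoints except at the two
  ends of the path, and these are multiples of \<open>k\<close>.\<close>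

lemma connected_total:
  assumes "u \<in> segments" "p \<in> u" "p \<notin> multiples k"
  obtains t where "connected_in \<A> u t" "p \<in> t"
proof -
  obtain C where C: "C \<in> \<A>" "u \<in> segments_of C" using obtain_curve assms(1) by blast
  obtain N w q r where w: "joining C N w q r" "{q, r} \<in> segments" using obtain_path[OF C(1)] .
  note w = w(1)
  obtain i where i: "i \<in> {0..<N}" "u = edge w i" using C path_segments_of[OF w] by auto
  have ends: "p \<noteq> w 0" "p \<noteq> w N" using w assms(3) dilate_multiples by (auto simp: joining_def)
  have C': "curve_of ({0..<N}, edge w) \<in> \<A>" using joiningD[OF w] by simp
  from assms(2) i have "p = w i \<or> p = w (i + 1)" by (auto simp: edge_def)
  then show thesis
  proof
    assume p: "p = w i"
    then have "i \<noteq> 0" using ends by auto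
    then have "connected_in \<A> u (edge w (i - 1))" using i
      by (intro connected_inI[OF C', of "i - 1"]) auto
    then show thesis using that p by (auto simp: edge_def)
  next
    assume p: "p = w (i + 1)"
    then have "i + 1 \<noteq> N" using ends by auto
    then have "connected_in \<A> u (edge w (i + 1))" using i
      by (intro connected_inI[OF C', of i]) auto
    then show thesis using that p by (auto simp: edge_def)
  qed
qed

lemma connected_in_path:
  assumes "connected_in \<A> u t" "joining C N w q r" "u \<in> segments_of C"
  shows "\<exists>i. 0 \<le> i \<and> i + 1 < N \<and>
    (u = edge w i \<and> t = edge w (i + 1) \<or> t = edge w i \<and> u = edge w (i + 1))"
proof -
  obtain D where D: "D \<in> \<A>" "\<And>I f. D = curve_of (I, f) \<Longrightarrow>
     \<exists>i. i \<in> I \<and> i + 1 \<in> I \<and> (u = f i \<and> t = f (i + 1) \<or> t = f i \<and> u = f (i + 1))"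
    using assms(1) by (rule connected_inE) blast
  obtain I f where f: "D = curve_of (I, f)" using curves[OF D(1)] by (auto simp: curves_def)
  have "u \<in> segments_of D" using D(2)[OF f] unfolding f segments_of_curve_of by blast
  then have "D = C" using curve_eqI[OF D(1) joiningD(1)[OF assms(2)] _ assms(3)] by simp
  then have "D = curve_of ({0..<N}, edge w)" using joiningD(3)[OF assms(2)] by simp
  from D(2)[OF this] show ?thesis by auto
qed

text \<open>Both connexions lie on the one self-avoiding path through \<open>u\<close>, at
  \<open>w (i + 1)\<close> and at \<open>w (j + 1)\<close>. If \<open>u\<close> comes first in both,
  or second in both, then \<open>i = j\<close>. In the mixed cases the two meeting points are the
  two distinct endpoints of \<open>u\<close>, yet both equal \<open>p\<close>.\<close>

lemma connected_unique:
  assumes "connected_in \<A> u t" "connected_in \<A> u t'" "p \<in> u" "p \<in> t" "p \<in> t'"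
  shows "t = t'"
proof -
  obtain C N w q r i where *: "joining C N w q r" "{q, r} \<in> segments" "0 \<le> i" "i + 1 < N"
    "u = edge w i \<and> t = edge w (i + 1) \<or> t = edge w i \<and> u = edge w (i + 1)"
    using obtain_connected_path[OF assms(1)] .
  note * = *(1,3-)
  have "u \<in> segments_of C" using * path_segments_of[OF *(1)] by auto
  then obtain j where j: "0 \<le> j" "j + 1 < N"
    "u = edge w j \<and> t' = edge w (j + 1) \<or> t' = edge w j \<and> u = edge w (j + 1)"
    using connected_in_path[OF assms(2) *(1)] by blast
  have inj: "m = n" if "edge w m = edge w n" "0 \<le> m" "m < N" "0 \<le> n" "n < N" for m n
    using inj_onD[OF path_inj[OF *(1)] that(1)] that(2-) by simp
  have p: "p = w (i + 1)" using path_edge_Int(2)[OF *(1-3)] *(4) assms(3-5)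
    by (metis IntI singletonD)
  have p': "p = w (j + 1)" using path_edge_Int(2)[OF *(1) j(1,2)] j(3) assms(3-5)
    by (metis IntI singletonD)
  have ne: "w n \<noteq> w (n + 1)" if "n \<in> {0..<N}" for n
    using path_segments[OF *(1) that] segment_neq by (auto simp: edge_def)
  consider "u = edge w i" "t = edge w (i + 1)" "u = edge w j" "t' = edge w (j + 1)"
    | "t = edge w i" "u = edge w (i + 1)" "t' = edge w j" "u = edge w (j + 1)"
    | "u = edge w i" "u = edge w (j + 1)"
    | "u = edge w (i + 1)" "u = edge w j"
    using *(4) j(3) by argo
  then show ?thesis
  proof cases
    case 1
    then have "edge w i = edge w j" by metis
    then have "i = j" by (rule inj) (use *(2,3) j(1,2) in simp_all)
    with 1 show ?thesis by metis
  next
    case 2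
    then have "edge w (i + 1) = edge w (j + 1)" by metis
    then have "i + 1 = j + 1" by (rule inj) (use *(2,3) j(1,2) in simp_all)
    then have "i = j" by simp
    with 2 show ?thesis by metis
  next
    case 3
    then have "edge w i = edge w (j + 1)" by metis
    then have "i = j + 1" by (rule inj) (use *(2,3) j(1,2) in simp_all)
    then show ?thesis using p p' ne[of i] *(2,3) by simp
  next
    case 4
    then have "edge w (i + 1) = edge w j" by metis
    then have "i + 1 = j" by (rule inj) (use *(2,3) j(1,2) in simp_all)
    then show ?thesis using p p' ne[of j] j(1,2) by simp
  qed
qed

end

section \<open>Convolution\<close>

lemma UN_consecutive_intervals:
  fixes m :: "int \<Rightarrow> int"
  assumes "0 \<le> N" "\<And>j. 0 \<le> j \<Longrightarrow> j < N \<Longrightarrow> m j < m (j + 1)"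
  shows "m 0 \<le> m N \<and> (\<Union>j\<in>{0..<N}. {m j..<m (j + 1)}) = {m 0..<m N}"
  using assms
proof (induction N rule: int_ge_induct)
  case (step n)
  have IH: "m 0 \<le> m n" "(\<Union>j\<in>{0..<n}. {m j..<m (j + 1)}) = {m 0..<m n}" using step by auto
  have "{0..<n + 1} = insert n {0..<n}" using step by auto
  then have "(\<Union>j\<in>{0..<n + 1}. {m j..<m (j + 1)}) = {m n..<m (n + 1)} \<union> {m 0..<m n}"
    by (simp only: UN_insert IH)
  moreover have "m n < m (n + 1)" using step by simp
  ultimately show ?case using IH(1) by auto
qed simp

text \<open>The invariant carried through convolutions: curves are finite vertex paths and every
  segment is reached. Uniqueness of connexions is treated later, on the connexion relation of the
  powers itself.\<close>

definition path_family :: "'n::finite curve set \<Rightarrow> bool" where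
  "path_family \<B> \<longleftrightarrow>
     (\<forall>D\<in>\<B>. \<exists>N v. 0 < N \<and> D = curve_of ({0..<N}, edge v) \<and> edge v ` {0..<N} \<subseteq> segments) \<and>
     (\<forall>s\<in>segments. \<exists>D\<in>\<B>. s \<in> segments_of D)"

lemma path_familyE:
  assumes "path_family \<B>" "D \<in> \<B>"
  obtains N v where "0 < N" "D = curve_of ({0..<N}, edge v)" "edge v ` {0..<N} \<subseteq> segments"
  using bspec[OF conjunct1[OF assms(1)[unfolded path_family_def]] assms(2)]
  by (elim exE conjE) (rule that)

lemma path_family_edge:
  assumes "path_family \<B>" "s \<in> segments"
  obtains N v j where "0 < N" "curve_of ({0..<N}, edge v) \<in> \<B>" "edge v ` {0..<N} \<subseteq> segments"
    "j \<in> {0..<N}" "s = edge v j"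
proof -
  obtain D where D: "D \<in> \<B>" "s \<in> segments_of D" using assms unfolding path_family_def by blast
  obtain N v where v: "0 < N" "D = curve_of ({0..<N}, edge v)" "edge v ` {0..<N} \<subseteq> segments"
    using path_familyE[OF assms(1) D(1)] .
  then show thesis using D that by (auto simp: segments_of_curve_of)
qed

text \<open>The representative inside \<open>conv\<close> is arbitrary, possibly reversed. A
  reversal of \<open>{0..<N}\<close> is still a block of \<open>N\<close> consecutive integers, so
  it is also a shift of \<open>{0..<N}\<close>, starting at \<open>c - N + 1\<close>.\<close>

lemma path_family_seq:
  assumes "path_family \<B>" "D \<in> \<B>" "(J, g) \<in> D"
  obtains a N where "0 < N" "J = (\<lambda>i. a + i) ` {0..<N}" "g ` J \<subseteq> segments"
proof -
  obtain N v where v: "0 < N" "D = curve_of ({0..<N}, edge v)" "edge v ` {0..<N} \<subseteq> segments"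
    using path_familyE[OF assms(1,2)] .
  have D: "D = curve_of (J, g)" using assms(3) v(2) by (simp add: mem_curve_of)
  have g: "g ` J \<subseteq> segments" using v by (metis D segments_of_curve_of)
  have "(({0..<N}, edge v), (J, g)) \<in> same_curve" using v(2) D by (simp add: curve_of_eq_iff[symmetric])
  then consider c where "J = (\<lambda>i. c + i) ` {0..<N}" | c where "J = (\<lambda>i. c - i) ` {0..<N}"
    by (auto simp: same_curve_iff)
  then show thesis
  proof cases
    case 1
    then show thesis using that v g by blast
  next
    case (2 c)
    have "(\<lambda>i. c - i) ` {0..<N} = (\<lambda>i. (c - N + 1) + i) ` {0..<N}"
      by (auto intro!: image_eqI[of _ _ "N - 1 - _"])
    then show thesis using that v g 2 by metis
  qed
qed

context H_covering
begin

text \<open>The condition in \<open>conv\<close>, with the index set normalized to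
  \<open>{0..<N}\<close>. A single sequence \<open>f\<close> carries all pieces, cut at the
  breakpoints \<open>m j\<close>.\<close>

definition pieces :: "int \<Rightarrow> (int \<Rightarrow> int ^ 'n) \<Rightarrow> (int \<Rightarrow> int) \<Rightarrow> (int \<Rightarrow> 'n segment) \<Rightarrow> bool" where
  "pieces N v m f \<longleftrightarrow> (\<forall>j\<in>{0..<N}. curve_of ({m j..<m (j + 1)}, f) \<in> \<A> \<and>
     leads f (m j) (m (j + 1)) (int k *s v j) (int k *s v (j + 1)))"

lemma piece_joining:
  assumes "curve_of ({a..<b}, f) \<in> \<A>" "leads f a b (int k *s q) (int k *s r)"
  obtains w where "joining (curve_of ({a..<b}, f)) (b - a) w q r"
    "\<forall>i\<in>{0..<b - a}. f (a + i) = edge w i"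
proof -
  have "a < b" using assms by (simp add: leads_def)
  then show thesis
    by (rule_tac leads_shift[OF assms(2)], rule_tac that) (use assms(1) in \<open>auto simp: joining_def\<close>)
qed

lemma piece_first:
  assumes "curve_of ({a..<b}, f) \<in> \<A>" "leads f a b (int k *s q) (int k *s r)"
  shows "end_seg q r (f a)"
proof -
  have "a < b" using assms by (simp add: leads_def)
  obtain w where w: "joining (curve_of ({a..<b}, f)) (b - a) w q r"
    "\<forall>i\<in>{0..<b - a}. f (a + i) = edge w i" using piece_joining[OF assms] .
  then show ?thesis unfolding end_seg_def using bspec[OF w(2), of 0] \<open>a < b\<close> by auto
qed

lemma piece_last:
  assumes "curve_of ({a..<b}, f) \<in> \<A>" "leads f a b (int k *s q) (int k *s r)"
  shows "end_seg r q (f (b - 1))"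
proof -
  have "a < b" using assms by (simp add: leads_def)
  obtain w where w: "joining (curve_of ({a..<b}, f)) (b - a) w q r"
    "\<forall>i\<in>{0..<b - a}. f (a + i) = edge w i" using piece_joining[OF assms] .
  have "f (b - 1) = edge (\<lambda>i. w (b - a - i)) 0"
    using bspec[OF w(2), of "b - a - 1"] \<open>a < b\<close> by (auto simp: edge_def)
  then show ?thesis unfolding end_seg_def using path_reverse[OF w(1)] by blast
qed

text \<open>The endpoints are compared as unordered pairs, because a curve of the family may run
  through the segment [q, r] in either direction.\<close>

lemma piece_eq_curve:
  assumes "curve_of ({a..<b}, f) \<in> \<A>" "leads f a b (int k *s q) (int k *s r)"
    and "joining C M w q' r'" "{q', r'} = {q, r}" "{q, r} \<in> segments"
  shows "curve_of ({a..<b}, f) = C"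
proof -
  obtain w' where w': "joining (curve_of ({a..<b}, f)) (b - a) w' q r"
    "\<forall>i\<in>{0..<b - a}. f (a + i) = edge w' i"
    using piece_joining[OF assms(1,2)] .
  have "\<exists>w. joining C M w q r" using assms(3,4) path_reverse by (metis doubleton_eq_iff)
  then show ?thesis using w'(1) path_exists_unique_curve[OF assms(5)] by blast
qed

lemma pieces_UN:
  assumes "pieces N v m f" "0 < N"
  shows "(\<Union>j\<in>{0..<N}. {m j..<m (j + 1)}) = {m 0..<m N}"
  using UN_consecutive_intervals[of N m] assms by (auto simp: pieces_def leads_def)

lemma pieces_subset:
  assumes "pieces N v m f" "j \<in> {0..<N}"
  shows "{m j..<m (j + 1)} \<subseteq> {m 0..<m N}"
  using pieces_UN[OF assms(1)] assms(2) by fastforce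

lemma pieces_exist:
  assumes "0 < N" "edge v ` {0..<N} \<subseteq> segments"
  obtains m f where "pieces N v m f"
proof -
  have "\<exists>m f. pieces N v m f" if "0 \<le> N" "edge v ` {0..<N} \<subseteq> segments" for N
    using that
  proof (induction N rule: int_ge_induct)
    case base
    show ?case by (simp add: pieces_def)
  next
    case (step n)
    then obtain m f where mf: "pieces n v m f" by (metis atLeastLessThan_iff image_subset_iff zless_add1_eq)
    have "{v n, v (n + 1)} \<in> segments" using step by (auto simp: edge_def)
    then obtain C M w where w: "joining C M w (v n) (v (n + 1))"
      using path_exists_unique_curve by blast
    \<comment> \<open>The new curve is appended after the last breakpoint \<open>m n\<close>: it
      occupies the next \<open>M\<close> indices, and \<open>edge w\<close> is shifted
      accordingly.\<close>
    define m' where "m' = (\<lambda>j. if j = n + 1 then m n + M else m j)"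
    define f' where "f' = (\<lambda>i. if i < m n then f i else edge w (i - m n))"
    have "curve_of ({m' j..<m' (j + 1)}, f') \<in> \<A> \<and>
       leads f' (m' j) (m' (j + 1)) (int k *s v j) (int k *s v (j + 1))" if j: "0 \<le> j" "j < n" for j
    proof -
      \<comment> \<open>Breakpoints increase, so every earlier piece lies below \<open>m n\<close>,
        where \<open>f'\<close> agrees with \<open>f\<close>.\<close>
      have "m (j + 1) \<le> m n"
      proof -
        have "m j < m (j + 1)" if "0 \<le> j" "j < n" for j
          using mf that by (auto simp: pieces_def leads_def)
        note inc = this
        have "i \<le> n \<longrightarrow> m (j + 1) \<le> m i" if "j + 1 \<le> i" for i
          using that
        proof (induction i rule: int_ge_induct)
          case (step i)
          then show ?case using inc[of i] j by auto
        qed simp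
        then show ?thesis using j by simp
      qed
      then have eq: "f' i = f i" if "i \<in> {m j..<m (j + 1)}" for i using that by (auto simp: f'_def)
      have "m' j = m j" "m' (j + 1) = m (j + 1)" using j by (auto simp: m'_def)
      moreover have "curve_of ({m j..<m (j + 1)}, f') = curve_of ({m j..<m (j + 1)}, f)"
        using eq by (rule curve_of_cong)
      moreover have "leads f' a b p q = leads f a b p q" if "a = m j" "b = m (j + 1)" for a b p q
        unfolding leads_def using eq that by simp
      ultimately show ?thesis using mf j by (simp add: pieces_def)
    qed
    moreover have "curve_of ({m' n..<m' (n + 1)}, f') \<in> \<A> \<and>
       leads f' (m' n) (m' (n + 1)) (int k *s v n) (int k *s v (n + 1))"
    proof
      have m': "m' n = m n" "m' (n + 1) = m n + M" by (auto simp: m'_def)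
      have "curve_of ({m n..<m n + M}, f') = curve_of ((\<lambda>i. m n + i) ` {0..<M}, f')"
        by (simp add: add.commute)
      also have "\<dots> = curve_of ({0..<M}, \<lambda>i. f' (m n + i))" by (rule curve_of_shift)
      also have "\<dots> = curve_of ({0..<M}, edge w)" by (rule curve_of_cong) (simp add: f'_def)
      finally show "curve_of ({m' n..<m' (n + 1)}, f') \<in> \<A>" using m' joiningD(4)[OF w] by simp
      show "leads f' (m' n) (m' (n + 1)) (int k *s v n) (int k *s v (n + 1))"
        unfolding leads_def m' using joiningD[OF w]
        by (intro conjI exI[of _ "\<lambda>i. w (i - m n)"]) (auto simp: f'_def edge_def algebra_simps)
    qed
    ultimately have "pieces (n + 1) v m' f'" unfolding pieces_def
      by (metis atLeastLessThan_iff zless_add1_eq)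
    then show ?case by blast
  qed
  then show thesis using assms that by force
qed

lemma convI:
  assumes "pieces N v m f" "0 < N" "curve_of ({0..<N}, edge v) \<in> \<B>"
  shows "curve_of ({m 0..<m N}, f) \<in> conv k \<A> \<B>"
proof -
  have 1: "({0..<N}, edge v) \<in> curve_of ({0..<N}, edge v)" by (simp add: mem_curve_of)
  have 2: "\<forall>j\<in>{0..<N}. edge v j = {v j, v (j + 1)} \<and> curve_of ({m j..<m (j + 1)}, f) \<in> \<A> \<and>
     leads f (m j) (m (j + 1)) (int k *s v j) (int k *s v (j + 1))"
    using assms(1) by (auto simp: pieces_def edge_def)
  show ?thesis unfolding conv_def mem_Collect_eq
    by (intro exI[of _ "{m 0..<m N}"] exI[of _ f] conjI refl bexI[OF _ assms(3)] bexI[OF _ 1])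
      (simp only: prod.case, intro exI[of _ v] exI[of _ m] conjI,
        rule pieces_UN[OF assms(1,2), symmetric], rule 2)
qed

lemma convE:
  assumes "C \<in> conv k \<A> \<B>" "path_family \<B>"
  obtains N v m f where "0 < N" "curve_of ({0..<N}, edge v) \<in> \<B>" "edge v ` {0..<N} \<subseteq> segments"
    "pieces N v m f" "C = curve_of ({m 0..<m N}, f)"
proof -
  obtain D J g I f v m where D: "D \<in> \<B>" "(J, g) \<in> D" "C = curve_of (I, f)"
    "I = (\<Union>j\<in>J. {m j..<m (j + 1)})"
    and g: "\<And>j. j \<in> J \<Longrightarrow> g j = {v j, v (j + 1)} \<and> curve_of ({m j..<m (j + 1)}, f) \<in> \<A> \<and>
        leads f (m j) (m (j + 1)) (int k *s v j) (int k *s v (j + 1))"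
    using assms(1) unfolding conv_def mem_Collect_eq Bex_def split_paired_Ex prod.case
    by (elim exE conjE) (rule that, assumption+, erule (1) bspec)
  obtain a N where N: "0 < N" "J = (\<lambda>i. a + i) ` {0..<N}" "g ` J \<subseteq> segments"
    using path_family_seq[OF assms(2) D(1,2)] .
  define v' where "v' = (\<lambda>j. v (a + j))"
  define m' where "m' = (\<lambda>j. m (a + j))"
  have J: "a + j \<in> J" if "j \<in> {0..<N}" for j using that N(2) by blast
  have g': "g (a + j) = edge v' j" if "j \<in> {0..<N}" for j
    using g[OF J[OF that]] by (simp add: edge_def v'_def add.assoc)
  have "pieces N v' m' f" unfolding pieces_def v'_def m'_def
    using g[OF J] by (simp add: add.assoc)
  moreover have "curve_of (J, g) \<in> \<B>"
    using D(1,2) path_familyE[OF assms(2) D(1)] by (metis mem_curve_of)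
  then have "curve_of ({0..<N}, edge v') \<in> \<B>"
    unfolding N(2) curve_of_shift using curve_of_cong[of "{0..<N}", OF g'] by simp
  moreover have "edge v' ` {0..<N} \<subseteq> segments"
    using g' N(3) J by (metis (no_types, lifting) image_subset_iff)
  moreover have "I = (\<Union>j\<in>{0..<N}. {m' j..<m' (j + 1)})"
    unfolding D(4) N(2) m'_def image_image by (simp only: UN_simps add.assoc)
  ultimately show thesis using that[of N v' m' f] N(1) D(3) pieces_UN by metis
qed

lemma pieces_segments:
  assumes "pieces N v m f" "0 < N"
  shows "f ` {m 0..<m N} \<subseteq> segments"
proof -
  have "f ` {m j..<m (j + 1)} \<subseteq> segments" if "j \<in> {0..<N}" for j
    using assms(1) that segments_of_subset segments_of_curve_of unfolding pieces_def by metis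
  then show ?thesis unfolding pieces_UN[OF assms, symmetric] by blast
qed

lemma pieces_leads:
  assumes "pieces N v m f" "0 < N"
  shows "leads f (m 0) (m N) (int k *s v 0) (int k *s v N)"
proof -
  have "0 < n \<longrightarrow> n \<le> N \<longrightarrow> leads f (m 0) (m n) (int k *s v 0) (int k *s v n)" if "0 \<le> n" for n
    using that
  proof (induction n rule: int_ge_induct)
    case (step n)
    show ?case
    proof (intro impI)
      assume "n + 1 \<le> N"
      then have *: "leads f (m n) (m (n + 1)) (int k *s v n) (int k *s v (n + 1))"
        using assms(1) step by (auto simp: pieces_def)
      show "leads f (m 0) (m (n + 1)) (int k *s v 0) (int k *s v (n + 1))"
      \<comment> \<open>\<open>leads\<close> demands a nonempty range, so the first piece cannot be
        appended to an empty start and is taken alone.\<close>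
      proof (cases "n = 0")
        case False
        then show ?thesis using step * \<open>n + 1 \<le> N\<close> leads_trans by force
      qed (use * in simp)
    qed
  qed simp
  then show ?thesis using assms(2) by simp
qed

text \<open>Every segment lies on a curve of \<open>\<A>\<close>, which joins k q to k r for some
  segment [q, r]. As [q, r] lies on a curve of \<open>\<B>\<close>, the given curve of
  \<open>\<A>\<close> occurs as a piece of the corresponding product.\<close>

lemma path_family_conv:
  assumes "path_family \<B>"
  shows "path_family (conv k \<A> \<B>)"
  unfolding path_family_def
proof (intro conjI ballI)
  fix C assume "C \<in> conv k \<A> \<B>"
  then obtain N v m f where f: "0 < N" "pieces N v m f" "C = curve_of ({m 0..<m N}, f)"
    using convE[OF _ assms] by metis
  note leads = pieces_leads[OF f(2,1)]
  then have "m 0 < m N" by (simp add: leads_def)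
  obtain w where w: "curve_of ({m 0..<m N}, f) = curve_of ({0..<m N - m 0}, edge w)"
    using leads_shift[OF leads] by metis
  have "edge w ` {0..<m N - m 0} = f ` {m 0..<m N}"
    using w by (metis segments_of_curve_of)
  then show "\<exists>N v. 0 < N \<and> C = curve_of ({0..<N}, edge v) \<and> edge v ` {0..<N} \<subseteq> segments"
    using w f(3) pieces_segments[OF f(2,1)] \<open>m 0 < m N\<close>
    by (intro exI[of _ "m N - m 0"] exI[of _ w]) auto
next
  fix s :: "'n segment" assume "s \<in> segments"
  then obtain C where C: "C \<in> \<A>" "s \<in> segments_of C" using obtain_curve by blast
  obtain M w q r where w: "joining C M w q r" "{q, r} \<in> segments" using obtain_path[OF C(1)] .
  obtain N v j where v: "0 < N" "curve_of ({0..<N}, edge v) \<in> \<B>" "edge v ` {0..<N} \<subseteq> segments"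
    "j \<in> {0..<N}" "{q, r} = edge v j"
    using path_family_edge[OF assms w(2)] .
  obtain m f where f: "pieces N v m f" using pieces_exist[OF v(1,3)] .
  have "curve_of ({m j..<m (j + 1)}, f) = C"
    by (rule piece_eq_curve[OF _ _ w(1), where q = "v j" and r = "v (j + 1)"])
      (use f v(4,5) w(2) in \<open>auto simp: pieces_def edge_def\<close>)
  then have "s \<in> f ` {m j..<m (j + 1)}" using C(2) segments_of_curve_of by metis
  then have "s \<in> f ` {m 0..<m N}" using pieces_subset[OF f v(4)] by blast
  then show "\<exists>C\<in>conv k \<A> \<B>. s \<in> segments_of C"
    using convI[OF f v(1,2)] segments_of_curve_of by metis
qed

text \<open>Two consecutive indices either belong to one piece, or are the last index of a piece and
  the first of the next. In the second case the two pieces meet at the dilated vertex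
  \<open>v (j + 1)\<close>, and both segments are end segments there.\<close>

lemma connected_conv_cases:
  assumes "path_family \<B>" "connected_in (conv k \<A> \<B>) s t"
  shows "connected_in \<A> s t \<or>
    (\<exists>p q r. connected_in \<B> {p, q} {p, r} \<and> end_seg p q s \<and> end_seg p r t)"
proof -
  obtain C where C: "C \<in> conv k \<A> \<B>" "\<And>I f. C = curve_of (I, f) \<Longrightarrow>
     \<exists>i. i \<in> I \<and> i + 1 \<in> I \<and> (s = f i \<and> t = f (i + 1) \<or> t = f i \<and> s = f (i + 1))"
    using assms(2) by (rule connected_inE) blast
  obtain N v m f where f: "0 < N" "curve_of ({0..<N}, edge v) \<in> \<B>" "edge v ` {0..<N} \<subseteq> segments"
    "pieces N v m f" "C = curve_of ({m 0..<m N}, f)" using convE[OF C(1) assms(1)] .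
  obtain i where i: "i \<in> {m 0..<m N}" "i + 1 \<in> {m 0..<m N}"
    "s = f i \<and> t = f (i + 1) \<or> t = f i \<and> s = f (i + 1)" using C(2)[OF f(5)] by blast
  obtain j where j: "j \<in> {0..<N}" "i \<in> {m j..<m (j + 1)}"
    using i(1) unfolding pieces_UN[OF f(4,1), symmetric] by blast
  have piece: "curve_of ({m j..<m (j + 1)}, f) \<in> \<A>"
    "leads f (m j) (m (j + 1)) (int k *s v j) (int k *s v (j + 1))" if "j \<in> {0..<N}" for j
    using f(4) that by (auto simp: pieces_def)
  show ?thesis
  proof (cases "i + 1 < m (j + 1)")
    case True
    have "connected_in \<A> s t"
      by (rule connected_inI[OF piece(1)[OF j(1)], of i]) (use j True i(3) in auto)
    then show ?thesis ..
  next
    case False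
    then have m: "m (j + 1) = i + 1" using j by simp
    then have "j + 1 \<noteq> N" using i(2) by auto
    then have j1: "j + 1 \<in> {0..<N}" using j(1) by auto
    have conn: "connected_in \<B> x y" if "x = edge v j \<and> y = edge v (j + 1) \<or> y = edge v j \<and> x = edge v (j + 1)" for x y
      by (rule connected_inI[OF f(2), of j]) (use j(1) j1 that in auto)
    have edges: "edge v j = {v (j + 1), v j}" "edge v (j + 1) = {v (j + 1), v (j + 1 + 1)}"
      by (auto simp: edge_def)
    have "end_seg (v (j + 1)) (v j) (f i)" using piece_last[OF piece[OF j(1)]] m by simp
    moreover have "end_seg (v (j + 1)) (v (j + 1 + 1)) (f (i + 1))"
      using piece_first[OF piece[OF j1]] m by simp
    ultimately show ?thesis using i(3) conn[unfolded edges] by blast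
  qed
qed

text \<open>Each curve of \<open>\<A>\<close> occurs as a piece of some product, with all its
  connexions.\<close>

lemma connected_convI_inner:
  assumes "path_family \<B>" "connected_in \<A> s t"
  shows "connected_in (conv k \<A> \<B>) s t"
proof -
  obtain C where C: "C \<in> \<A>" "\<And>I f. C = curve_of (I, f) \<Longrightarrow>
     \<exists>i. i \<in> I \<and> i + 1 \<in> I \<and> (s = f i \<and> t = f (i + 1) \<or> t = f i \<and> s = f (i + 1))"
    using assms(2) by (rule connected_inE) blast
  obtain M w q r where w: "joining C M w q r" "{q, r} \<in> segments" using obtain_path[OF C(1)] .
  obtain N v j where v: "0 < N" "curve_of ({0..<N}, edge v) \<in> \<B>" "edge v ` {0..<N} \<subseteq> segments"
    "j \<in> {0..<N}" "{q, r} = edge v j"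
    using path_family_edge[OF assms(1) w(2)] .
  obtain m f where f: "pieces N v m f" using pieces_exist[OF v(1,3)] .
  have "curve_of ({m j..<m (j + 1)}, f) = C"
    by (rule piece_eq_curve[OF _ _ w(1), where q = "v j" and r = "v (j + 1)"])
      (use f v(4,5) w(2) in \<open>auto simp: pieces_def edge_def\<close>)
  from C(2)[OF this[symmetric]] obtain i where i: "i \<in> {m j..<m (j + 1)}" "i + 1 \<in> {m j..<m (j + 1)}"
    "s = f i \<and> t = f (i + 1) \<or> t = f i \<and> s = f (i + 1)" by blast
  show ?thesis
    by (rule connected_inI[OF convI[OF f v(1,2)] _ _ i(3)]) (use i pieces_subset[OF f v(4)] in blast)+
qed

text \<open>Distinctness of the two segments identifies \<open>p\<close>: their intersection is the
  single vertex \<open>v (j + 1)\<close>. By \<open>end_seg_unique\<close>, \<open>s\<close> and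
  \<open>t\<close> are then the very segments that the two pieces place on either side of this
  junction.\<close>

lemma connected_convI_junction:
  assumes "path_family \<B>" "connected_in \<B> {p, q} {p, r}" "{p, q} \<noteq> {p, r}"
    "end_seg p q s" "end_seg p r t"
  shows "connected_in (conv k \<A> \<B>) s t"
proof -
  obtain D where D: "D \<in> \<B>" "\<And>I f. D = curve_of (I, f) \<Longrightarrow> \<exists>i. i \<in> I \<and> i + 1 \<in> I \<and>
     ({p, q} = f i \<and> {p, r} = f (i + 1) \<or> {p, r} = f i \<and> {p, q} = f (i + 1))"
    using assms(2) by (rule connected_inE) blast
  obtain N v where v: "0 < N" "D = curve_of ({0..<N}, edge v)" "edge v ` {0..<N} \<subseteq> segments"
    using path_familyE[OF assms(1) D(1)] .
  obtain j where j: "j \<in> {0..<N}" "j + 1 \<in> {0..<N}"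
    "{p, q} = edge v j \<and> {p, r} = edge v (j + 1) \<or> {p, r} = edge v j \<and> {p, q} = edge v (j + 1)"
    using D(2)[OF v(2)] by blast
  obtain m f where f: "pieces N v m f" using pieces_exist[OF v(1,3)] .
  have piece: "curve_of ({m j..<m (j + 1)}, f) \<in> \<A>"
    "leads f (m j) (m (j + 1)) (int k *s v j) (int k *s v (j + 1))" if "j \<in> {0..<N}" for j
    using f that by (auto simp: pieces_def)
  have m: "m j < m (j + 1)" "m (j + 1) < m (j + 1 + 1)"
    using piece(2)[OF j(1)] piece(2)[OF j(2)] by (auto simp: leads_def)
  have seg: "edge v j \<in> segments" "edge v (j + 1) \<in> segments" using v(3) j by auto
  have last: "end_seg (v (j + 1)) (v j) (f (m (j + 1) - 1))" using piece_last[OF piece[OF j(1)]] .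
  have first: "end_seg (v (j + 1)) (v (j + 1 + 1)) (f (m (j + 1)))" using piece_first[OF piece[OF j(2)]] .
  have ne: "edge v j \<noteq> edge v (j + 1)" using j(3) assms(3) by metis
  have "edge v j \<inter> edge v (j + 1) = {v (j + 1)}" using ne by (rule edge_Int)
  moreover have "p \<in> edge v j \<inter> edge v (j + 1)" using j(3) by blast
  ultimately have p: "v (j + 1) = p" by simp
  have neq: "v j \<noteq> p" "v (j + 1 + 1) \<noteq> p" using seg p segment_neq unfolding edge_def by metis+
  consider "q = v j" "r = v (j + 1 + 1)" | "r = v j" "q = v (j + 1 + 1)"
    using j(3) neq by (auto simp: edge_def p doubleton_eq_iff)
  then have "s = f (m (j + 1) - 1) \<and> t = f (m (j + 1)) \<or> t = f (m (j + 1) - 1) \<and> s = f (m (j + 1))"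
    by cases (use end_seg_unique last first seg assms(4,5) p in \<open>metis edge_def insert_commute\<close>)+
  moreover have "m (j + 1) - 1 \<in> {m 0..<m N}" "m (j + 1) - 1 + 1 \<in> {m 0..<m N}"
    using pieces_subset[OF f j(1)] pieces_subset[OF f j(2)] m by auto
  ultimately show ?thesis
    using connected_inI[OF convI[OF f v(1)], of \<B> "m (j + 1) - 1"] D(1) v(2) by simp
qed

end

section \<open>Connexions of the powers\<close>

lemma segments_Int:
  assumes "s \<in> segments" "t \<in> segments" "s \<noteq> t" "p \<in> s" "p \<in> t"
  shows "s \<inter> t = {p}"
proof -
  obtain y z where "s = {p, y}" "t = {p, z}" using assms segment_cases by metis
  then show ?thesis using assms(3) by auto
qed

lemma multiples_mult: "0 < k \<Longrightarrow> int k *s q \<in> multiples (k * m) \<longleftrightarrow> q \<in> multiples m"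
  by (simp add: multiples_iff)

lemma path_family_single_segments: 
  "path_family {curve_of ({0}, \<lambda>_. s) | s. s \<in> (segments :: 'n::finite segment set)}"
  unfolding path_family_def
proof (intro conjI ballI)
  fix D :: "'n curve" assume "D \<in> {curve_of ({0}, \<lambda>_. s) | s. s \<in> segments}"
  then obtain s where s: "D = curve_of ({0}, \<lambda>_. s)" "s \<in> segments" by blast
  then obtain x i where x: "s = {x, x + axis i 1}" by (auto simp: segments_def)
  define v :: "int \<Rightarrow> int ^ 'n" where "v = (\<lambda>j. if j = 0 then x else x + axis i 1)"
  have "{0..<1::int} = {0}" by auto
  moreover have "edge v 0 = s" by (simp add: edge_def v_def x)
  moreover from this have "curve_of ({0}, edge v) = curve_of ({0}, \<lambda>_. s)"
    by (intro curve_of_cong) simp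
  ultimately show "\<exists>N v. 0 < N \<and> D = curve_of ({0..<N}, edge v) \<and> edge v ` {0..<N} \<subseteq> segments"
    using s by (intro exI[of _ 1] exI[of _ v]) simp
next
  fix s :: "'n segment" assume "s \<in> segments"
  then show "\<exists>D\<in>{curve_of ({0}, \<lambda>_. s) | s. s \<in> segments}. s \<in> segments_of D"
    by (intro bexI[of _ "curve_of ({0}, \<lambda>_. s)"]) (auto simp: segments_of_curve_of)
qed

lemma not_connected_single_segments:
  "\<not> connected_in {curve_of ({0}, \<lambda>_. s) | s. P s} s t"
proof
  assume "connected_in {curve_of ({0}, \<lambda>_. s) | s. P s} s t"
  then obtain C where C: "C \<in> {curve_of ({0}, \<lambda>_. s) | s. P s}" "\<And>I f. C = curve_of (I, f) \<Longrightarrow>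
     \<exists>i. i \<in> I \<and> i + 1 \<in> I \<and> (s = f i \<and> t = f (i + 1) \<or> t = f i \<and> s = f (i + 1))"
    by (rule connected_inE) blast
  from C(1) obtain s' where "C = curve_of ({0}, \<lambda>_. s')" by blast
  from C(2)[OF this] show False by auto
qed

text \<open>Here \<open>m\<close> stands for l / k. The dilation by \<open>k\<close> turns a
  translation by a multiple of \<open>m\<close> into one that preserves \<open>\<A>\<close>.\<close>

locale periodic_covering = H_covering +
  fixes m :: nat
  assumes translate: "w \<in> multiples (k * m) \<Longrightarrow> C \<in> \<A> \<Longrightarrow> translate_curve w C \<in> \<A>"

context H_covering
begin

abbreviation con :: "nat \<Rightarrow> 'n segment \<Rightarrow> 'n segment \<Rightarrow> bool" where
  "con r \<equiv> connected_in (conv_power k \<A> r)"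

lemma path_family_power: "path_family (conv_power k \<A> r)"
proof (induction r)
  case 0
  show ?case unfolding conv_power.simps by (rule path_family_single_segments)
next
  case (Suc r)
  then show ?case unfolding conv_power.simps by (rule path_family_conv)
qed

lemma not_con_0: "\<not> con 0 s t"
  unfolding conv_power.simps by (rule not_connected_single_segments)

lemma con_Suc_cases:
  assumes "con (Suc r) s t"
  obtains "connected_in \<A> s t"
  | p x y where "con r {p, x} {p, y}" "end_seg p x s" "end_seg p y t"
  using connected_conv_cases[OF path_family_power] assms unfolding conv_power.simps by metis

text \<open>Distinctness is included because \<open>connected_convI_junction\<close> asks for it;
  \<open>end_seg_inj\<close> carries it from a point q to k q.\<close>

lemma con_Int: "con r s t \<Longrightarrow> s \<in> segments \<and> t \<in> segments \<and> s \<noteq> t \<and> (\<exists>p. s \<inter> t = {p})"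
proof (induction r arbitrary: s t)
  case (Suc r)
  from Suc.prems show ?case
  proof (cases rule: con_Suc_cases)
    case 1
    have "s \<noteq> t"
    proof
      assume "s = t"
      obtain p where "s \<inter> t = {p}" using connected_Int[OF 1] by blast
      with \<open>s = t\<close> have "{p, p} \<in> segments" using connected_Int[OF 1] by simp
      then show False using segment_neq by blast
    qed
    then show ?thesis using connected_Int[OF 1] by blast
  next
    case (2 p x y)
    have "x \<noteq> y" using Suc.IH[OF 2(1)] by blast
    then have "s \<noteq> t" using end_seg_inj 2 by blast
    moreover from this have "s \<inter> t = {int k *s p}" using end_seg_mem[OF 2(2)] end_seg_mem[OF 2(3)]
      by (intro segments_Int) auto
    ultimately show ?thesis using end_seg_mem[OF 2(2)] end_seg_mem[OF 2(3)] by blast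
  qed
qed (simp add: not_con_0 del: conv_power.simps)

lemma con_SucI_inner: "connected_in \<A> s t \<Longrightarrow> con (Suc r) s t"
  unfolding conv_power.simps by (rule connected_convI_inner[OF path_family_power])

lemma con_SucI_junction:
  "con r {p, x} {p, y} \<Longrightarrow> end_seg p x s \<Longrightarrow> end_seg p y t \<Longrightarrow> con (Suc r) s t"
  unfolding conv_power.simps using con_Int
  by (intro connected_convI_junction[OF path_family_power]) blast+

lemma con_sym: "con r s t \<Longrightarrow> con r t s"
proof (induction r arbitrary: s t)
  case (Suc r)
  from Suc.prems show ?case
    by (cases rule: con_Suc_cases) (blast intro: connected_sym Suc.IH con_SucI_inner con_SucI_junction)+
qed (simp add: not_con_0 del: conv_power.simps)

text \<open>The relation \<open>\<prec>\<close> between successive powers. Connexions of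
  \<open>\<A>\<close> occur in every power after the first step, and those at dilated points are
  lifted from the points below by induction, starting from a power without connexions.\<close>

lemma con_Suc_mono: "con r s t \<Longrightarrow> con (Suc r) s t"
proof (induction r arbitrary: s t)
  case (Suc r)
  from Suc.prems show ?case
    by (cases rule: con_Suc_cases) (blast intro: Suc.IH con_SucI_inner con_SucI_junction)+
qed (simp add: not_con_0 del: conv_power.simps)

lemma con_mono: "r \<le> r' \<Longrightarrow> con r s t \<Longrightarrow> con r' s t"
  by (induction r' rule: dec_induct) (blast intro: con_Suc_mono)+

text \<open>Outside the multiples of \<open>k\<close> the connexion is one of \<open>\<A>\<close>.
  At k q, \<open>end_seg_surj\<close> brings \<open>u\<close> down to a segment at q, the induction
  hypothesis connects that one at q, and its partner is lifted back to an end segment at k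
  q.\<close>

lemma con_total:
  assumes "u \<in> segments" "p \<in> u" "p \<notin> multiples (k ^ r)"
  shows "\<exists>t. con r u t \<and> p \<in> t"
  using assms
proof (induction r arbitrary: u p)
  case 0
  then show ?case by (simp add: multiples_iff)
next
  case (Suc r)
  show ?case
  proof (cases "p \<in> multiples k")
    case False
    obtain t where "connected_in \<A> u t" "p \<in> t"
      using connected_total[OF Suc.prems(1,2) False] .
    then show ?thesis using con_SucI_inner by blast
  next
    case True
    then obtain q where p: "p = int k *s q" by (auto simp: multiples_def)
    then have q: "q \<notin> multiples (k ^ r)" using Suc.prems(3) multiples_mult[OF k_pos, of q "k ^ r"] by (metis power_Suc)
    obtain x where x: "{q, x} \<in> segments" "end_seg q x u"
      using end_seg_surj Suc.prems(1,2) p by blast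
    obtain t where t: "con r {q, x} t" "q \<in> t" using Suc.IH[OF x(1) _ q] by blast
    then have "t \<in> segments" using con_Int by blast
    then obtain y where y: "t = {q, y}" using t(2) segment_cases by metis
    then obtain t' where t': "end_seg q y t'" using end_seg_exists \<open>t \<in> segments\<close> by blast
    then have "con (Suc r) u t'" using con_SucI_junction t(1) x(2) y by blast
    then show ?thesis using end_seg_mem(1)[OF t'] p by blast
  qed
qed

text \<open>The two kinds of connexions never compete at one point: those of \<open>\<A>\<close>
  avoid the multiples of \<open>k\<close>, those induced from the preceding power occur only there.
  In the induced case both connexions descend to the same segment at the same q, where the induction
  hypothesis applies.\<close>

lemma con_unique:
  assumes "con r u t" "con r u t'" "p \<in> u" "p \<in> t" "p \<in> t'"
  shows "t = t'"
  using assms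
proof (induction r arbitrary: u t t' p)
  case 0
  then show ?case using not_con_0 by blast
next
  case (Suc r)
  \<comment> \<open>Connected segments share exactly one point, so a dilated point lying on both
    must be \<open>p\<close>.\<close>
  have at: "int k *s q = p" if "int k *s q \<in> u" "int k *s q \<in> s" "con (Suc r) u s" "p \<in> s" for s q
    using con_Int[OF that(3)] that Suc.prems(3) by (metis IntI singletonD)
  from Suc.prems(1) show ?case
  proof (cases rule: con_Suc_cases)
    case 1
    note inner = this
    from Suc.prems(2) show ?thesis
    proof (cases rule: con_Suc_cases)
      case 1
      show ?thesis using connected_unique[OF inner 1 Suc.prems(3-5)] .
    next
      case (2 q x y)
      then have "int k *s q = p" using at end_seg_mem(1) Suc.prems by blast
      then show ?thesis using not_connected_at_multiple[OF inner] Suc.prems by blast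
    qed
  next
    case (2 q x y)
    note junction = this
    then have q: "int k *s q = p" using at end_seg_mem(1) Suc.prems by blast
    from Suc.prems(2) show ?thesis
    proof (cases rule: con_Suc_cases)
      case 1
      then show ?thesis using not_connected_at_multiple[OF 1] Suc.prems q by blast
    next
      case (2 q' x' y')
      then have "int k *s q' = p" using at end_seg_mem(1) Suc.prems by blast
      then have [simp]: "q' = q" using q dilate_inj by metis
      have [simp]: "x' = x" using end_seg_inj junction(2) 2(2) by simp
      have "{q, y} = {q, y'}" using Suc.IH[OF junction(1), of "{q, y'}" q] 2(1) by simp
      moreover have seg: "{q, y} \<in> segments" using con_Int[OF junction(1)] by blast
      ultimately have "y' = y" by (auto simp: doubleton_eq_iff)
      then show ?thesis using end_seg_unique[OF junction(3) _ seg] 2(3) by simp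
    qed
  qed
qed

end

section \<open>Periodicity of the powers\<close>

context periodic_covering
begin

lemma edge_translate: "edge (\<lambda>i. w + v i) i = translate_seg w (edge v i)"
  by (simp add: edge_def translate_seg_insert)

lemma edge_translate': "edge (\<lambda>i. w + v i) = (\<lambda>i. translate_seg w (edge v i))"
  using edge_translate by (rule ext)

lemma joining_translate:
  assumes "w \<in> multiples m" "joining C N v q r"
  shows "joining (translate_curve (int k *s w) C) N (\<lambda>i. int k *s w + v i) (w + q) (w + r)"
proof -
  have "int k *s w \<in> multiples (k * m)" using assms(1) multiples_mult[OF k_pos] by blast
  then have "translate_curve (int k *s w) C \<in> \<A>" using translate joiningD(1)[OF assms(2)] by blast
  moreover have "translate_curve (int k *s w) C = curve_of ({0..<N}, edge (\<lambda>i. int k *s w + v i))"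
    unfolding joiningD(3)[OF assms(2)] translate_curve_of by (simp only: edge_translate')
  ultimately show ?thesis using joiningD[OF assms(2)] by (simp add: joining_def vec_eq_iff distrib_left)
qed

lemma end_seg_translate:
  "w \<in> multiples m \<Longrightarrow> end_seg q r u \<Longrightarrow> end_seg (w + q) (w + r) (translate_seg (int k *s w) u)"
  unfolding end_seg_def using joining_translate edge_translate by metis

lemma connected_translate:
  assumes "w \<in> multiples m" "connected_in \<A> s t"
  shows "connected_in \<A> (translate_seg (int k *s w) s) (translate_seg (int k *s w) t)"
proof -
  obtain C N v q r i where *: "joining C N v q r" "{q, r} \<in> segments" "0 \<le> i" "i + 1 < N"
    "s = edge v i \<and> t = edge v (i + 1) \<or> t = edge v i \<and> s = edge v (i + 1)"
    using obtain_connected_path[OF assms(2)] .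
  show ?thesis
    by (rule connected_inI[OF joiningD(4)[OF joining_translate[OF assms(1) *(1)]], of i])
      (use *(3-) in \<open>auto simp: edge_translate\<close>)
qed

text \<open>A translation by k v in one power corresponds to a translation by v in the preceding
  one, so each step of the induction strips one factor \<open>k\<close>. The factor \<open>m\<close>
  survives, which keeps \<open>\<A>\<close> itself invariant under k v.\<close>

lemma con_translate:
  assumes "w \<in> multiples (m * k ^ r)" "con r s t"
  shows "con r (translate_seg w s) (translate_seg w t)"
  using assms
proof (induction r arbitrary: w s t)
  case (Suc r)
  from Suc.prems(1) have "w \<in> multiples (k * (m * k ^ r))" by (simp add: mult_ac)
  then obtain y where y: "w = int (k * (m * k ^ r)) *s y" unfolding multiples_def by blast
  define v where "v = int (m * k ^ r) *s y"
  have v: "w = int k *s v" "v \<in> multiples (m * k ^ r)"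
    unfolding y v_def by (simp add: vec_eq_iff) (simp add: multiples_def)
  then have vm: "v \<in> multiples m" by (auto simp: multiples_iff dest: dvd_mult_left)
  from Suc.prems(2) show ?case
  proof (cases rule: con_Suc_cases)
    case 1
    then show ?thesis using connected_translate[OF vm] v con_SucI_inner by blast
  next
    case (2 p x y)
    have "con r {v + p, v + x} {v + p, v + y}"
      using Suc.IH[OF v(2) 2(1)] by (simp add: translate_seg_insert)
    then show ?thesis using end_seg_translate[OF vm] 2(2,3) v(1) con_SucI_junction by blast
  qed
qed (simp add: not_con_0 del: conv_power.simps)

end

section \<open>The completed limit\<close>

lemma translate_seg_inj: "translate_seg w s = translate_seg w t \<longleftrightarrow> s = t"
  unfolding translate_seg_def by (simp add: inj_image_eq_iff)

lemma translate_seg_subset: "translate_seg w s \<subseteq> (+) w ` P \<longleftrightarrow> s \<subseteq> P"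
  unfolding translate_seg_def by (simp add: inj_image_subset_iff)

lemma translate_seg_ex: "\<exists>s'. s = translate_seg w s'"
  by (rule exI[of _ "translate_seg (- w) s"]) (simp add: translate_seg_add translate_seg_0)

lemma translation_equal_trans:
  assumes "translation_equal p q" "translation_equal q r"
  shows "translation_equal p r"
proof -
  obtain v w where "fst q = translate_seg v ` fst p"
    "snd q = map_prod (translate_seg v) (translate_seg v) ` snd p"
    "fst r = translate_seg w ` fst q"
    "snd r = map_prod (translate_seg w) (translate_seg w) ` snd q"
    using assms unfolding translation_equal_def by (elim exE conjE) (rule that; assumption)
  moreover have "translate_seg w \<circ> translate_seg v = translate_seg (w + v)"
    by (rule ext) (simp add: translate_seg_add)
  ultimately show ?thesis unfolding translation_equal_def
    by (intro exI[of _ "w + v"] conjI) (simp_all only: image_comp map_prod_compose[symmetric])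
qed

lemma cube_translate: "(+) w ` cube x h = cube (w + x) h"
proof -
  have "y \<in> (+) w ` cube x h" if "y \<in> cube (w + x) h" for y
    by (rule image_eqI[of _ _ "y - w"]) (use that in \<open>auto simp: cube_def algebra_simps\<close>)
  then show ?thesis by (auto simp: cube_def algebra_simps)
qed

lemma cube_center_unique:
  assumes "cube x h = cube y h"
  shows "x = y"
proof -
  have "x $ i \<le> y $ i" if "cube x h = cube y h" for x y :: "int ^ 'n" and i
  proof -
    have "(\<chi> i. x $ i + int h) \<in> cube x h" by (simp add: cube_def)
    then have "(\<chi> i. x $ i + int h) \<in> cube y h" using that by simp
    then show ?thesis by (simp add: cube_def)
  qed
  then show ?thesis using assms by (metis vec_eq_iff order_antisym)
qed

text \<open>Recovers the cube from a pattern: since \<open>1 \<le> h\<close>, each point has a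
  neighbour in the cube in any coordinate direction, forward unless it lies on the upper face, and
  backward there.\<close>

lemma Union_segments_cube:
  assumes "1 \<le> h"
  shows "\<Union> {s \<in> segments. s \<subseteq> cube x h} = cube (x :: int ^ 'n::finite) h"
proof (intro equalityI subsetI)
  fix y assume y: "y \<in> cube x h"
  have bound: "x $ j - int h \<le> y $ j \<and> y $ j \<le> x $ j + int h" for j
    using y by (simp add: cube_def)
  obtain i :: 'n where True by simp
  show "y \<in> \<Union> {s \<in> segments. s \<subseteq> cube x h}"
  proof (cases "y $ i < x $ i + int h")
    case True
    have "x $ j - int h \<le> (y + axis i 1) $ j \<and> (y + axis i 1) $ j \<le> x $ j + int h" for j
      using bound[of j] True by (auto simp: axis_def)
    then have "y + axis i 1 \<in> cube x h" by (simp only: cube_def mem_Collect_eq) blast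
    moreover have "{y, y + axis i 1} \<in> segments" by (auto simp: segments_def)
    ultimately show ?thesis using y by (intro UnionI[of "{y, y + axis i 1}"]) auto
  next
    case False
    have "x $ j - int h \<le> (y - axis i 1) $ j \<and> (y - axis i 1) $ j \<le> x $ j + int h" for j
      using bound[of j] False assms by (auto simp: axis_def)
    then have "y - axis i 1 \<in> cube x h" by (simp only: cube_def mem_Collect_eq) blast
    moreover have "{y, y - axis i 1} \<in> segments" by (simp add: segments_iff unit_vectors_def)
    ultimately show ?thesis using y by (intro UnionI[of "{y, y - axis i 1}"]) auto
  qed
qed auto

lemma translation_equal_restrictionI:
  fixes \<E> :: "'n::finite curve set"
  assumes "\<And>s. (\<exists>C\<in>\<E>. s \<in> segments_of C) \<longleftrightarrow> s \<in> segments"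
    and "\<And>s t. s \<subseteq> P \<Longrightarrow> t \<subseteq> P \<Longrightarrow>
      connected_in \<E> s t \<longleftrightarrow> connected_in \<E> (translate_seg w s) (translate_seg w t)"
  shows "translation_equal (restriction \<E> P) (restriction \<E> ((+) w ` P))"
  unfolding translation_equal_def restriction_def fst_conv snd_conv assms(1)
proof (intro exI[of _ w] conjI equalityI subsetI)
  fix s assume s: "s \<in> {s. s \<subseteq> (+) w ` P \<and> s \<in> segments}"
  obtain s' where "s = translate_seg w s'" using translate_seg_ex by blast
  then show "s \<in> translate_seg w ` {s. s \<subseteq> P \<and> s \<in> segments}"
    using s by (simp add: translate_seg_subset translate_seg_mem_segments)
next
  fix p assume p: "p \<in> {(s, t). s \<subseteq> (+) w ` P \<and> t \<subseteq> (+) w ` P \<and> connected_in \<E> s t}"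
  obtain s t where "p = (translate_seg w s, translate_seg w t)"
    using translate_seg_ex by (metis surj_pair)
  then show "p \<in> map_prod (translate_seg w) (translate_seg w) `
      {(s, t). s \<subseteq> P \<and> t \<subseteq> P \<and> connected_in \<E> s t}"
    using p assms(2) by (auto simp: translate_seg_subset)
next
  fix s assume "s \<in> translate_seg w ` {s. s \<subseteq> P \<and> s \<in> segments}"
  then obtain s' where "s = translate_seg w s'" "s' \<subseteq> P" "s' \<in> segments" by blast
  then show "s \<in> {s. s \<subseteq> (+) w ` P \<and> s \<in> segments}"
    by (simp add: translate_seg_subset translate_seg_mem_segments)
next
  fix p assume "p \<in> map_prod (translate_seg w) (translate_seg w) `
      {(s, t). s \<subseteq> P \<and> t \<subseteq> P \<and> connected_in \<E> s t}"
  then obtain s t where "p = (translate_seg w s, translate_seg w t)"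
    "s \<subseteq> P" "t \<subseteq> P" "connected_in \<E> s t" by (auto simp only: map_prod_simp mem_Collect_eq prod.case)
  then show "p \<in> {(s, t). s \<subseteq> (+) w ` P \<and> t \<subseteq> (+) w ` P \<and> connected_in \<E> s t}"
    using assms(2)[of s t] by (simp add: translate_seg_subset)
qed

text \<open>The vector hidden in \<open>translation_equal\<close> is forced to be
  \<open>x - y\<close>: the segments of a pattern fill its cube, and a cube determines its centre.
  This allows the equality to be restricted to smaller cubes.\<close>

lemma translation_equal_restrictionD:
  fixes \<E> :: "'n::finite curve set"
  assumes "\<And>s. (\<exists>C\<in>\<E>. s \<in> segments_of C) \<longleftrightarrow> s \<in> segments" "1 \<le> h"
    and eq: "translation_equal (restriction \<E> (cube y h)) (restriction \<E> (cube x h))"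
    and st: "s \<subseteq> cube y h" "t \<subseteq> cube y h"
  shows "connected_in \<E> s t \<longleftrightarrow>
    connected_in \<E> (translate_seg (x - y) s) (translate_seg (x - y) t)"
proof -
  obtain w where w1: "{s. s \<subseteq> cube x h \<and> s \<in> segments} =
       translate_seg w ` {s. s \<subseteq> cube y h \<and> s \<in> segments}"
    and w2: "{(s, t). s \<subseteq> cube x h \<and> t \<subseteq> cube x h \<and> connected_in \<E> s t} =
       map_prod (translate_seg w) (translate_seg w) `
         {(s, t). s \<subseteq> cube y h \<and> t \<subseteq> cube y h \<and> connected_in \<E> s t}"
    using eq unfolding translation_equal_def restriction_def fst_conv snd_conv assms(1)
    by (elim exE conjE) (rule that; assumption)
  have "cube x h = \<Union> (translate_seg w ` {s. s \<subseteq> cube y h \<and> s \<in> segments})"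
    unfolding w1[symmetric] using Union_segments_cube[OF assms(2), of x] by (simp add: conj_commute)
  also have "\<dots> = (+) w ` \<Union> {s \<in> segments. s \<subseteq> cube y h}"
    by (auto simp: translate_seg_def)
  also have "\<dots> = cube (w + y) h" unfolding Union_segments_cube[OF assms(2)] cube_translate ..
  finally have "x = w + y" by (rule cube_center_unique)
  then have w: "x - y = w" by simp
  have sub: "translate_seg w s \<subseteq> cube x h" "translate_seg w t \<subseteq> cube x h"
    using st translate_seg_subset[of w _ "cube y h"] unfolding cube_translate w[symmetric] by simp_all
  show ?thesis unfolding w
  proof
    assume "connected_in \<E> s t"
    then have "(s, t) \<in> {(s, t). s \<subseteq> cube y h \<and> t \<subseteq> cube y h \<and> connected_in \<E> s t}"
      using st by simp
    then have "map_prod (translate_seg w) (translate_seg w) (s, t) \<in>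
      {(s, t). s \<subseteq> cube x h \<and> t \<subseteq> cube x h \<and> connected_in \<E> s t}" unfolding w2 by (rule imageI)
    then show "connected_in \<E> (translate_seg w s) (translate_seg w t)" by simp
  next
    assume "connected_in \<E> (translate_seg w s) (translate_seg w t)"
    then have "(translate_seg w s, translate_seg w t) \<in>
      {(s, t). s \<subseteq> cube x h \<and> t \<subseteq> cube x h \<and> connected_in \<E> s t}" using sub by simp
    then obtain p where p: "(translate_seg w s, translate_seg w t) =
        map_prod (translate_seg w) (translate_seg w) p"
      "p \<in> {(s, t). s \<subseteq> cube y h \<and> t \<subseteq> cube y h \<and> connected_in \<E> s t}"
      unfolding w2 by (rule imageE)
    from p(1) have "p = (s, t)" by (cases p) (simp add: translate_seg_inj)
    with p(2) show "connected_in \<E> s t" by simp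
  qed
qed

section \<open>Links of the completed limit, and recurrence of its patterns\<close>

locale completed_covering = periodic_covering k \<A> m
  for k :: nat and \<A> :: "'n::finite curve set" and m :: nat +
  fixes R :: "int ^ 'n \<Rightarrow> int ^ 'n \<Rightarrow> bool"
  assumes k_ge_2: "2 \<le> k" and m_pos: "0 < m" and pairing: "pairing_on unit_vectors R"
begin

definition linked :: "'n segment \<Rightarrow> 'n segment \<Rightarrow> bool" where
  "linked s t \<longleftrightarrow> (\<exists>r. con r s t) \<or> (\<exists>u v. s = {0, u} \<and> t = {0, v} \<and> R u v)"

abbreviation limit :: "'n curve set" where
  "limit \<equiv> completed_limit k \<A> R"

lemma limit_eq: "limit = {curve_of (UNIV, f) | f. curve_seq (UNIV, f) \<and> (\<forall>i. linked (f i) (f (i + 1)))}"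
  unfolding completed_limit_def linked_def limit_connected_def ..

lemma linked_sym: "linked s t \<Longrightarrow> linked t s"
  using pairing con_sym unfolding linked_def pairing_on_def by metis

lemma linked_Int:
  assumes "linked s t"
  shows "s \<in> segments \<and> t \<in> segments \<and> s \<noteq> t \<and> (\<exists>p. s \<inter> t = {p})"
  using assms unfolding linked_def
proof (elim disjE exE conjE)
  fix u v assume st: "s = {0, u}" "t = {0, v}" and R: "R u v"
  then have uv: "u \<in> unit_vectors" "v \<in> unit_vectors" "u \<noteq> v"
    using pairing by (auto simp: pairing_on_def)
  then have "s \<in> segments" "t \<in> segments" by (simp_all add: st segments_iff)
  moreover have "s \<noteq> t" using uv by (auto simp: st doubleton_eq_iff)
  ultimately show ?thesis using segments_Int[of s t 0] st by blast
qed (rule con_Int)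

text \<open>This is where \<open>k \<ge> 2\<close> enters. Together with
  \<open>multiple_eq_0\<close> it makes 0 the only multiple of \<open>k ^ r\<close> in a given
  bounded region, for \<open>r\<close> large enough.\<close>

lemma obtain_power_gt:
  obtains r where "b < int (k ^ r)"
proof -
  have "nat b < 2 ^ nat b" by simp
  also have "2 ^ nat b \<le> k ^ nat b" using k_ge_2 by (rule power_mono) simp
  finally show thesis by (intro that[of "nat b"]) linarith
qed

lemma multiple_eq_0:
  assumes "y \<in> multiples M" "\<And>i. \<bar>y $ i\<bar> < int M"
  shows "y = 0"
proof -
  have "y $ i = 0" for i
    using assms(1) assms(2)[of i] dvd_imp_le_int[of "y $ i" "int M"] by (force simp: multiples_iff)
  then show ?thesis by (simp add: vec_eq_iff)
qed

lemma linked_total: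
  assumes "s \<in> segments" "p \<in> s"
  shows "\<exists>t. linked s t \<and> p \<in> t"
proof (cases "p = 0")
  case True
  then obtain u where u: "s = {0, u}" using assms segment_cases by metis
  then have "u \<in> unit_vectors" using assms(1) by (simp add: segments_iff)
  then obtain v where "R u v" using pairing unfolding pairing_on_def by blast
  then show ?thesis using u True by (auto simp: linked_def)
next
  case False
  obtain r where r: "(\<Sum>i\<in>UNIV. \<bar>p $ i\<bar>) < int (k ^ r)" by (rule obtain_power_gt)
  have "\<bar>p $ i\<bar> < int (k ^ r)" for i
    using r member_le_sum[of i UNIV "\<lambda>i. \<bar>p $ i\<bar>"] by simp
  then have "p \<notin> multiples (k ^ r)" using multiple_eq_0 False by blast
  then show ?thesis using con_total[OF assms] unfolding linked_def by blast
qed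

text \<open>What is iterated is a directed segment, that is, a pair of successive vertices, because
  the next vertex depends on the direction of arrival.\<close>

lemma linked_walk:
  assumes "{x, y} \<in> segments"
  obtains g :: "nat \<Rightarrow> int ^ 'n" where "g 0 = x" "g 1 = y"
    "\<And>n. linked {g n, g (Suc n)} {g (Suc n), g (Suc (Suc n))}"
proof -
  have "\<exists>z. linked {x, y} {y, z}" if xy: "{x, y} \<in> segments" for x y
  proof -
    obtain t where t: "linked {x, y} t" "y \<in> t" using linked_total[OF xy] by blast
    then obtain z where "t = {y, z}" using segment_cases linked_Int by metis
    then show ?thesis using t by blast
  qed
  then obtain next_vertex where
    nxt: "\<And>x y. {x, y} \<in> segments \<Longrightarrow> linked {x, y} {y, next_vertex x y}" by metis
  define st where "st n = ((\<lambda>(x, y). (y, next_vertex x y)) ^^ n) (x, y)" for n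
  have st: "st 0 = (x, y)" "st (Suc n) = (snd (st n), next_vertex (fst (st n)) (snd (st n)))" for n
    by (simp_all add: st_def case_prod_beta)
  have seg: "{fst (st n), snd (st n)} \<in> segments" for n
  proof (induction n)
    case (Suc n)
    then show ?case using linked_Int[OF nxt[OF Suc.IH]] by (simp add: st)
  qed (use assms in \<open>simp add: st\<close>)
  show thesis
  proof (rule that[of "\<lambda>n. fst (st n)"])
    show "linked {fst (st n), fst (st (Suc n))} {fst (st (Suc n)), fst (st (Suc (Suc n)))}" for n
      using nxt[OF seg[of n]] by (simp add: st)
  qed (simp_all add: st)
qed

text \<open>The limit consists of two-sided infinite curves, so a link counts as a connexion only
  after it has been prolonged in both directions. By \<open>linked_total\<close> a walk never gets
  stuck; one walk leaves the common point through each of the two segments.\<close>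

lemma linked_imp_connected:
  assumes "linked s t"
  shows "connected_in limit s t"
proof -
  obtain p where "p \<in> s" "p \<in> t" using linked_Int[OF assms] by blast
  then obtain a b where ab: "s = {p, a}" "t = {p, b}"
    using linked_Int[OF assms] segment_cases by metis
  obtain g where g: "g 0 = p" "g 1 = b" "\<And>n. linked {g n, g (Suc n)} {g (Suc n), g (Suc (Suc n))}"
    using linked_walk[of p b] linked_Int[OF assms] ab by metis
  obtain h where h: "h 0 = p" "h 1 = a" "\<And>n. linked {h n, h (Suc n)} {h (Suc n), h (Suc (Suc n))}"
    using linked_walk[of p a] linked_Int[OF assms] ab by metis
  \<comment> \<open>The walks \<open>g\<close> and \<open>h\<close> both start at \<open>p\<close>,
    which receives index 0; hence \<open>s\<close> is the edge from -1 to 0 and \<open>t\<close> the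
    edge from 0 to 1. The walk \<open>h\<close> is read backwards.\<close>
  define w where "w i = (if 0 \<le> i then g (nat i) else h (nat (- i)))" for i
  have s: "edge w (- 1) = s" and t: "edge w 0 = t"
    using ab g(1,2) h(1,2) by (auto simp: edge_def w_def)
  have linked: "linked (edge w i) (edge w (i + 1))" for i
  proof -
    \<comment> \<open>The given link at \<open>p\<close>, then the links along \<open>g\<close>,
      then those along \<open>h\<close>, where the backward reading calls for
      \<open>linked_sym\<close>.\<close>
    consider "i = - 1" | n where "i = int n" | n where "i = - int n - 2"
    proof -
      have "i = - 1 \<or> i = int (nat i) \<or> i = - int (nat (- i - 2)) - 2" by arith
      then show thesis using that by blast
    qed
    then show ?thesis
    proof cases
      case 1
      then show ?thesis using s t assms by simp
    next
      case (2 n)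
      then have "w i = g n" "w (i + 1) = g (Suc n)" "w (i + 1 + 1) = g (Suc (Suc n))"
        by (simp_all add: w_def nat_add_distrib)
      then show ?thesis using g(3) by (simp add: edge_def)
    next
      case (3 n)
      then have "w i = h (Suc (Suc n))" "w (i + 1) = h (Suc n)" "w (i + 1 + 1) = h n"
        using g(1) h(1) by (auto simp: w_def nat_add_distrib)
      then show ?thesis using linked_sym[OF h(3)[of n]] by (simp add: edge_def insert_commute)
    qed
  qed
  have Int: "edge w i \<inter> edge w (i + 1) = {w (i + 1)}" for i
    using linked_Int[OF linked[of i]] edge_Int by blast
  have "w i \<noteq> w (i + 1)" for i
    using linked_Int[OF linked[of i]] segment_neq unfolding edge_def by blast
  then have "edge w i \<inter> edge w (i + 1) \<noteq> edge w (i + 1) \<inter> edge w (i + 2)" for i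
    using Int[of i] Int[of "i + 1"] by (metis add.assoc one_add_one singleton_inject)
  moreover have "\<exists>!p. p \<in> edge w i \<and> p \<in> edge w (i + 1)" for i
    using Int[of i] by (metis Int_iff singleton_iff)
  moreover have "edge w i \<in> segments" for i using linked_Int[OF linked[of i]] by blast
  ultimately have "curve_of (UNIV, edge w) \<in> limit" unfolding limit_eq curve_seq_def
    using linked by blast
  then show ?thesis by (rule connected_inI[of _ _ _ "- 1"]) (use s t in auto)
qed

lemma connected_limit_iff: "connected_in limit s t \<longleftrightarrow> linked s t"
proof
  assume "connected_in limit s t"
  then obtain C where C: "C \<in> limit" "\<And>I f. C = curve_of (I, f) \<Longrightarrow>
     \<exists>i. i \<in> I \<and> i + 1 \<in> I \<and> (s = f i \<and> t = f (i + 1) \<or> t = f i \<and> s = f (i + 1))"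
    by (rule connected_inE) blast
  from C(1) obtain f where f: "C = curve_of (UNIV, f)" "\<And>i. linked (f i) (f (i + 1))"
    unfolding limit_eq by blast
  then show "linked s t" using C(2)[OF f(1)] linked_sym by metis
qed (rule linked_imp_connected)

lemma segments_of_limit: "(\<exists>C\<in>limit. s \<in> segments_of C) \<longleftrightarrow> s \<in> segments"
proof
  assume "\<exists>C\<in>limit. s \<in> segments_of C"
  then show "s \<in> segments" by (auto simp: limit_eq segments_of_curve_of curve_seq_def)
next
  assume s: "s \<in> segments"
  then obtain x where "x \<in> s" by (auto simp: segments_def)
  then obtain t where "linked s t" using linked_total[OF s] by blast
  then have "connected_in limit s t" by (rule linked_imp_connected)
  then show "\<exists>C\<in>limit. s \<in> segments_of C"
    unfolding connected_in_def segments_of_def by blast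
qed

text \<open>Away from the multiples of \<open>k ^ r\<close>, all the connexions of the limit are already present
  in the power of exponent \<open>r\<close>, because there every segment is connected at both endpoints.\<close>
lemma linked_iff_con:
  assumes "P \<inter> multiples (k ^ r) = {}" "s \<subseteq> P" "t \<subseteq> P"
  shows "linked s t \<longleftrightarrow> con r s t"
proof
  assume "linked s t"
  obtain p where p: "p \<in> s" "p \<in> t" using linked_Int[OF \<open>linked s t\<close>] by blast
  have "0 \<in> multiples (k ^ r)" by (simp add: multiples_iff)
  then have "0 \<notin> s" using assms by blast
  then obtain r' where r': "con r' s t" using \<open>linked s t\<close> unfolding linked_def by blast
  have "p \<notin> multiples (k ^ r)" using assms p by blast
  then obtain t' where t': "con r s t'" "p \<in> t'"
    using con_total p(1) linked_Int[OF \<open>linked s t\<close>] by blast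
  have "con (max r r') s t" "con (max r r') s t'"
    using con_mono[OF _ r', of "max r r'"] con_mono[OF _ t'(1), of "max r r'"] by simp_all
  then have "t = t'" using con_unique p t'(2) by blast
  then show "con r s t" using t'(1) by simp
qed (auto simp: linked_def)

text \<open>For large \<open>r\<close> the cube contains no multiple of \<open>k ^ r\<close>, and
  neither do its translates by such multiples. In all of them the links are exactly the connexions
  of the power \<open>r\<close>, which are periodic.\<close>

lemma periodic_off_0:
  assumes "0 \<notin> cube x h"
  obtains M where "0 < M" "\<And>w. w \<in> multiples M \<Longrightarrow>
    translation_equal (restriction limit (cube (w + x) h)) (restriction limit (cube x h))"
proof -
  obtain r where r: "(\<Sum>i\<in>UNIV. \<bar>x $ i\<bar>) + int h < int (k ^ r)" by (rule obtain_power_gt)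
  have empty: "cube x h \<inter> multiples (k ^ r) = {}"
  proof (rule ccontr)
    assume "cube x h \<inter> multiples (k ^ r) \<noteq> {}"
    then obtain y where y: "y \<in> cube x h" "y \<in> multiples (k ^ r)" by blast
    have "\<bar>y $ i\<bar> < int (k ^ r)" for i
    proof -
      have "\<bar>y $ i\<bar> \<le> \<bar>x $ i\<bar> + int h" using y(1) by (auto simp: cube_def abs_le_iff)
        (smt (verit))+
      moreover have "\<bar>x $ i\<bar> \<le> (\<Sum>i\<in>UNIV. \<bar>x $ i\<bar>)"
        using member_le_sum[of i UNIV "\<lambda>i. \<bar>x $ i\<bar>"] by simp
      ultimately show ?thesis using r by linarith
    qed
    then have "y = 0" using multiple_eq_0 y(2) by blast
    then show False using assms y(1) by simp
  qed
  show thesis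
  \<comment> \<open>Divisibility by \<open>k ^ r\<close> keeps the translated cube away from the
    multiples of \<open>k ^ r\<close>; the additional factor \<open>m\<close> gives the invariance
    of \<open>con r\<close>.\<close>
  proof (rule that[of "m * k ^ r"])
    show "0 < m * k ^ r" using m_pos k_pos by simp
    fix w :: "int ^ 'n" assume w: "w \<in> multiples (m * k ^ r)"
    then have neg: "- w \<in> multiples (m * k ^ r)" by (simp add: multiples_iff)
    have wk: "w \<in> multiples (k ^ r)" using w by (auto simp: multiples_iff dest: dvd_mult_right)
    have empty': "cube (w + x) h \<inter> multiples (k ^ r) = {}"
    proof -
      have "w + y \<in> multiples (k ^ r) \<longleftrightarrow> y \<in> multiples (k ^ r)" for y
        using wk by (simp add: multiples_iff dvd_add_right_iff)
      then show ?thesis using empty unfolding cube_translate[symmetric] by blast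
    qed
    have "translation_equal (restriction limit (cube (w + x) h))
      (restriction limit ((+) (- w) ` cube (w + x) h))"
    proof (rule translation_equal_restrictionI)
      fix s t assume st: "s \<subseteq> cube (w + x) h" "t \<subseteq> cube (w + x) h"
      have sub: "translate_seg (- w) s \<subseteq> cube x h" "translate_seg (- w) t \<subseteq> cube x h"
        using st translate_seg_subset[of "- w" _ "cube (w + x) h"] unfolding cube_translate by simp_all
      have "con r s t \<longleftrightarrow> con r (translate_seg (- w) s) (translate_seg (- w) t)"
        using con_translate[OF neg, of s t]
          con_translate[OF w, of "translate_seg (- w) s" "translate_seg (- w) t"]
        by (auto simp: translate_seg_add translate_seg_0)
      then show "connected_in limit s t \<longleftrightarrow>
          connected_in limit (translate_seg (- w) s) (translate_seg (- w) t)"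
        unfolding connected_limit_iff using linked_iff_con[OF empty' st] linked_iff_con[OF empty sub]
        by simp
    qed (rule segments_of_limit)
    then show "translation_equal (restriction limit (cube (w + x) h)) (restriction limit (cube x h))"
      unfolding cube_translate by simp
  qed
qed

text \<open>Applied to the cube around \<open>x\<close>, (C) could return another cube containing 0.
  It is therefore applied to a large cube around 0 that contains the given one, and the copy of the
  smaller cube is cut out of the copy of the larger.\<close>

lemma obtain_translate_off_0:
  assumes "condition_C limit" "1 \<le> h"
  obtains y where "0 \<notin> cube y h"
    "translation_equal (restriction limit (cube y h)) (restriction limit (cube x h))"
proof -
  \<comment> \<open>This size serves twice: the cube of radius \<open>H\<close> around 0 contains
    the given one, and some coordinate of \<open>y\<close> exceeds \<open>H\<close> in absolute
    value, which \<open>x\<close> and \<open>h\<close> together cannot compensate.\<close>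
  define H where "H = nat (\<Sum>i\<in>UNIV. \<bar>x $ i\<bar>) + h"
  have H: "\<bar>x $ i\<bar> + int h \<le> int H" for i
    using member_le_sum[of i UNIV "\<lambda>i. \<bar>x $ i\<bar>"] by (simp add: H_def sum_nonneg)
  have "1 \<le> H" using assms(2) by (simp add: H_def)
  then obtain y where y: "y \<notin> cube 0 H"
    "translation_equal (restriction limit (cube y H)) (restriction limit (cube 0 H))"
    using assms(1) unfolding condition_C_def by blast
  have sub: "cube (y + x) h \<subseteq> cube y H"
  proof
    fix z assume "z \<in> cube (y + x) h"
    then have "y $ i + x $ i - int h \<le> z $ i \<and> z $ i \<le> y $ i + x $ i + int h" for i
      by (simp add: cube_def)
    then have "y $ i - int H \<le> z $ i \<and> z $ i \<le> y $ i + int H" for i using H[of i] by (smt (verit))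
    then show "z \<in> cube y H" by (simp add: cube_def)
  qed
  show thesis
  proof
    obtain i where "\<not> (- int H \<le> y $ i \<and> y $ i \<le> int H)" using y(1) by (auto simp: cube_def)
    then have "\<not> (y $ i + x $ i - int h \<le> 0 \<and> 0 \<le> y $ i + x $ i + int h)" using H[of i] by linarith
    then show "0 \<notin> cube (y + x) h" by (auto simp: cube_def)
    have "translation_equal (restriction limit (cube (y + x) h))
      (restriction limit ((+) (- y) ` cube (y + x) h))"
    proof (rule translation_equal_restrictionI)
      fix s t assume "s \<subseteq> cube (y + x) h" "t \<subseteq> cube (y + x) h"
      then show "connected_in limit s t \<longleftrightarrow>
          connected_in limit (translate_seg (- y) s) (translate_seg (- y) t)"
        using translation_equal_restrictionD[OF segments_of_limit \<open>1 \<le> H\<close> y(2), of s t] sub by auto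
    qed (rule segments_of_limit)
    then show "translation_equal (restriction limit (cube (y + x) h)) (restriction limit (cube x h))"
      unfolding cube_translate by simp
  qed
qed

lemma multiples_relatively_dense:
  fixes c :: "real ^ 'n" and x :: "int ^ 'n"
  assumes "0 < M"
  obtains w where "w \<in> multiples M" "dist c (real_point (w + x)) \<le> real CARD('n) * real M"
proof -
  \<comment> \<open>Each coordinate of \<open>c - x\<close> is rounded down to a multiple of
    \<open>M\<close>, with an error of at most \<open>M\<close>. Bounding the Euclidean norm by the
    sum of the coordinate errors gives the radius, which does not depend on
    \<open>c\<close>.\<close>
  define w :: "int ^ 'n" where "w = (\<chi> i. int M * \<lfloor>(c $ i - real_of_int (x $ i)) / real M\<rfloor>)"
  have bound: "\<bar>(c - real_point (w + x)) $ i\<bar> \<le> real M" for i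
  proof -
    define a where "a = (c $ i - real_of_int (x $ i)) / real M"
    have "c $ i - real_of_int (x $ i) = real M * a" using assms by (simp add: a_def)
    then have "(c - real_point (w + x)) $ i = real M * (a - of_int \<lfloor>a\<rfloor>)"
      by (simp add: real_point_def w_def a_def[symmetric] algebra_simps)
    moreover have "0 \<le> a - of_int \<lfloor>a\<rfloor>" "a - of_int \<lfloor>a\<rfloor> \<le> 1" by linarith+
    ultimately show ?thesis by (simp add: abs_mult mult_left_le)
  qed
  have "dist c (real_point (w + x)) \<le> (\<Sum>i\<in>UNIV. \<bar>(c - real_point (w + x)) $ i\<bar>)"
    unfolding dist_norm by (rule norm_le_l1_cart)
  also have "\<dots> \<le> (\<Sum>i\<in>(UNIV :: 'n set). real M)" by (rule sum_mono) (rule bound)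
  finally have "dist c (real_point (w + x)) \<le> real CARD('n) * real M" by simp
  moreover have "w \<in> multiples M" by (simp add: multiples_iff w_def)
  ultimately show thesis using that by blast
qed

lemma local_isomorphism:
  assumes "condition_C limit"
  shows "local_isomorphism_property limit"
  unfolding local_isomorphism_property_def
proof (intro allI impI)
  fix x :: "int ^ 'n" and h :: nat assume "1 \<le> h"
  then obtain y where y: "0 \<notin> cube y h"
    "translation_equal (restriction limit (cube y h)) (restriction limit (cube x h))"
    using obtain_translate_off_0[OF assms] by blast
  obtain M where M: "0 < M" "\<And>w. w \<in> multiples M \<Longrightarrow>
    translation_equal (restriction limit (cube (w + y) h)) (restriction limit (cube y h))"
    using periodic_off_0[OF y(1)] by blast
  show "\<exists>t::real. t \<ge> 0 \<and> (\<forall>c. \<exists>z. real_point z \<in> cball c t \<and>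
    translation_equal (restriction limit (cube z h)) (restriction limit (cube x h)))"
  proof (intro exI[of _ "real CARD('n) * real M"] conjI allI)
    fix c :: "real ^ 'n"
    obtain w where "w \<in> multiples M" "dist c (real_point (w + y)) \<le> real CARD('n) * real M"
      using multiples_relatively_dense[OF M(1)] .
    then show "\<exists>z. real_point z \<in> cball c (real CARD('n) * real M) \<and>
      translation_equal (restriction limit (cube z h)) (restriction limit (cube x h))"
      using translation_equal_trans[OF M(2) y(2)] by (intro exI[of _ "w + y"]) simp
  qed simp
qed

end

theorem proposition1p1:
  fixes k l :: nat
    and \<A> :: "'n::finite curve set"
    and R :: "int ^ 'n \<Rightarrow> int ^ 'n \<Rightarrow> bool"
  assumes "CARD('n) \<ge> 2"
    and "k \<ge> 2"
    and "l > 0" and "k dvd l"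
    and "condition_H k l \<A>"
    and "pairing_on unit_vectors R"
    and "condition_C (completed_limit k \<A> R)"
  shows "local_isomorphism_property (completed_limit k \<A> R)"
proof -
  obtain m where m: "l = k * m" using assms(4) by blast
  interpret completed_covering k \<A> m R
  proof
    show "0 < k" "2 \<le> k" "0 < m" using assms(2,3) m by auto
    show "covering \<A>" "pairing_on unit_vectors R"
      using assms(5,6) by (simp_all add: condition_H_def)
    show "\<exists>x\<in>multiples k. \<exists>i. joins C x (x + axis i (int k))" if "C \<in> \<A>" for C
      using assms(5) that by (simp add: condition_H_def)
    show "\<exists>!C. C \<in> \<A> \<and> joins C x (x + axis i (int k))" if "x \<in> multiples k" for x i
      using assms(5) that by (simp add: condition_H_def)
    show "translate_curve w C \<in> \<A>" if "w \<in> multiples (k * m)" "C \<in> \<A>" for w C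
      using assms(5) that unfolding condition_H_def m by blast
  qed
  show ?thesis using assms(7) by (rule local_isomorphism)
qed

end
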